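(* Let $G$ be a metric graph-like space, let $v\in G$ be an isolated vertex of finite degree $d$, and let $S\in\mathbf I_1(G)$. Suppose that there is a star neighborhood $U$ of $v$ such that, on each of the open edge segments incident to $v$ forming the connected components of $U\setminus\{v\}$, the multiplicity of $S$ is one (that is, $\theta_S=1$) $\mathcal H^1$-almost everywhere. Write $$\partial S=\sum_{j=1}^N m_j[\![x_j]\!]$$ with distinct points $x_j\in G$ and nonzero integers $m_j$, and let $m_v$ be the coefficient of $\partial S$ at $v$ (with $m_v=0$ if $v\notin\{x_1,\dots,x_N\}$). Then $$m_v\equiv d\pmod 2.$$ In particular, if $d$ is odd, then $m_v\neq 0$.
   Context: Currents are metric currents in the sense of Ambrosio–Kirchheim in a complete metric space $Z$; $\mathbf I_k(Z)$ is the group of integral $k$-currents (integer rectifiable currents of finite mass whose boundary is also integer rectifiable of finite mass), $\partial$ is the boundary, and $[\![x]\!]$ is the $0$-current $f\mapsto f(x)$. Every $R\in\mathbf I_0(Z)$ is a finite sum $\sum_j m_j[\![x_j]\!]$ with nonzero integers $m_j$ and distinct points $x_j$. For an integer rectifiable current $S$, $\theta_S$ denotes the intrinsic nonnegative integer multiplicity in the Ambrosio–Kirchheim rectifiable representation (the absolute value of the signed integer coefficient relative to a chosen orientation). A metric graph-like space is the metric completion of a finite or countable one-dimensional length complex obtained by gluing compact intervals along endpoints, with pairwise disjoint edge interiors. Local finiteness at accumulation points is not assumed. An isolated vertex $v$ of finite degree $d$ is assumed to have an ordinary finite star neighborhood: a neighborhood containing no other vertex (nor limit of vertices), consisting, for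 small $\rho>0$, of $d$ geodesic arms $\gamma_i:[0,\rho]\to G$ with $\gamma_i(0)=v$, parametrized isometrically and meeting only at $v$. The degree is the number of these arms. *)

theory Defs
  imports "HOL-Analysis.Analysis" "HOL-Number_Theory.Cong"
begin

section \<open>One-dimensional Hausdorff measure\<close>

definition hausdorff1_premeasure :: "real \<Rightarrow> 'a::metric_space set \<Rightarrow> ennreal" where
  "hausdorff1_premeasure \<delta> A =
     (INF C\<in>{C :: nat \<Rightarrow> 'a set. A \<subseteq> (\<Union>i. C i) \<and> (\<forall>i. bounded (C i) \<and> diameter (C i) \<le> \<delta>)}.
        \<Sum>i. ennreal (diameter (C i)))"

text \<open>This is an outer measure, defined on all subsets; the normalising constant
  $\omega_1/2$ equals 1.\<close>

definition hausdorff1 :: "'a::metric_space set \<Rightarrow> ennreal" where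
  "hausdorff1 A = (SUP \<delta>\<in>{0<..}. hausdorff1_premeasure \<delta> A)"

definition countably_rectifiable1 :: "'a::metric_space set \<Rightarrow> bool" where
  "countably_rectifiable1 S \<longleftrightarrow>
     (\<exists>(A :: nat \<Rightarrow> real set) (g :: nat \<Rightarrow> real \<Rightarrow> 'a).
        (\<forall>j. A j \<in> sets borel \<and> (\<exists>L. L-lipschitz_on (A j) (g j))) \<and>
        hausdorff1 (S - (\<Union>j. g j ` A j)) = 0)"


section \<open>Metric currents of dimension 0 and 1 (Ambrosio--Kirchheim)\<close>

definition lip :: "('a::metric_space \<Rightarrow> real) \<Rightarrow> bool" where
  "lip f \<longleftrightarrow> (\<exists>L. L-lipschitz_on UNIV f)"

definition lip_b :: "('a::metric_space \<Rightarrow> real) \<Rightarrow> bool" where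
  "lip_b f \<longleftrightarrow> lip f \<and> bounded (range f)"

text \<open>A 0-current is a functional $T(f)$ and a 1-current a functional $T(f,\pi)$, with $f$ bounded
  Lipschitz and $\pi$ Lipschitz.  They are represented by total functions; only the values on such
  arguments are meaningful, and currents are only ever compared there.\<close>

type_synonym 'a functional0 = "('a \<Rightarrow> real) \<Rightarrow> real"
type_synonym 'a functional1 = "('a \<Rightarrow> real) \<Rightarrow> ('a \<Rightarrow> real) \<Rightarrow> real"

definition mass_bound0 :: "'a::metric_space functional0 \<Rightarrow> 'a measure \<Rightarrow> bool" where
  "mass_bound0 T \<mu> \<longleftrightarrow> finite_measure \<mu> \<and> sets \<mu> = sets borel \<and>
     (\<forall>f. lip_b f \<longrightarrow> \<bar>T f\<bar> \<le> (LINT x|\<mu>. \<bar>f x\<bar>))"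

definition mass_bound1 :: "'a::metric_space functional1 \<Rightarrow> 'a measure \<Rightarrow> bool" where
  "mass_bound1 T \<mu> \<longleftrightarrow> finite_measure \<mu> \<and> sets \<mu> = sets borel \<and>
     (\<forall>f \<pi> L. lip_b f \<longrightarrow> L-lipschitz_on UNIV \<pi> \<longrightarrow> \<bar>T f \<pi>\<bar> \<le> L * (LINT x|\<mu>. \<bar>f x\<bar>))"

definition current0 :: "'a::metric_space functional0 \<Rightarrow> bool" where
  "current0 T \<longleftrightarrow>
     (\<forall>f g a b. lip_b f \<longrightarrow> lip_b g \<longrightarrow> T (\<lambda>x. a * f x + b * g x) = a * T f + b * T g) \<and>
     (\<exists>\<mu>. mass_bound0 T \<mu>)"

text \<open>The conjuncts are: linearity in $f$, linearity in $\pi$, continuity, locality, finite mass.\<close>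

definition current1 :: "'a::metric_space functional1 \<Rightarrow> bool" where
  "current1 T \<longleftrightarrow>
     (\<forall>f g \<pi> a b. lip_b f \<longrightarrow> lip_b g \<longrightarrow> lip \<pi> \<longrightarrow>
        T (\<lambda>x. a * f x + b * g x) \<pi> = a * T f \<pi> + b * T g \<pi>) \<and>
     (\<forall>f \<pi> \<pi>' a b. lip_b f \<longrightarrow> lip \<pi> \<longrightarrow> lip \<pi>' \<longrightarrow>
        T f (\<lambda>x. a * \<pi> x + b * \<pi>' x) = a * T f \<pi> + b * T f \<pi>') \<and>
     (\<forall>f (p :: nat \<Rightarrow> 'a \<Rightarrow> real) \<pi> L.
        lip_b f \<longrightarrow> (\<forall>n. L-lipschitz_on UNIV (p n)) \<longrightarrow> (\<forall>x. (\<lambda>n. p n x) \<longlonglongrightarrow> \<pi> x) \<longrightarrow>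
        (\<lambda>n. T f (p n)) \<longlonglongrightarrow> T f \<pi>) \<and>
     (\<forall>f \<pi>. lip_b f \<longrightarrow> lip \<pi> \<longrightarrow>
        (\<exists>W k. open W \<and> {x. f x \<noteq> 0} \<subseteq> W \<and> (\<forall>x\<in>W. \<pi> x = k)) \<longrightarrow> T f \<pi> = 0) \<and>
     (\<exists>\<mu>. mass_bound1 T \<mu>)"

definition mass_measure :: "'a::metric_space functional1 \<Rightarrow> 'a measure" where
  "mass_measure T =
     (THE \<mu>. mass_bound1 T \<mu> \<and>
        (\<forall>\<nu>. mass_bound1 T \<nu> \<longrightarrow> (\<forall>A\<in>sets borel. emeasure \<mu> A \<le> emeasure \<nu> A)))"

definition mass :: "'a::metric_space functional1 \<Rightarrow> real" where
  "mass T = measure (mass_measure T) UNIV"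

definition boundary :: "'a::metric_space functional1 \<Rightarrow> 'a functional0" where
  "boundary T f = T (\<lambda>_. 1) f"

definition point_current :: "'a \<Rightarrow> 'a functional0" where
  "point_current x f = f x"

definition pushforward :: "('a \<Rightarrow> 'b) \<Rightarrow> 'a functional1 \<Rightarrow> 'b functional1" where
  "pushforward g T f \<pi> = T (\<lambda>x. f (g x)) (\<lambda>x. \<pi> (g x))"

text \<open>The extension of $T(\cdot,\pi)$ to bounded Borel functions, by density of the bounded
  Lipschitz functions in $L^1(\|T\|)$.\<close>

definition borel_extension :: "'a::metric_space functional1 \<Rightarrow> 'a functional1" where
  "borel_extension T h \<pi> =
     (THE r. \<forall>g :: nat \<Rightarrow> 'a \<Rightarrow> real.
        (\<forall>n. lip_b (g n)) \<longrightarrow> (\<lambda>n. LINT x|mass_measure T. \<bar>g n x - h x\<bar>) \<longlonglongrightarrow> 0 \<longrightarrow>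
        (\<lambda>n. T (g n) \<pi>) \<longlonglongrightarrow> r)"

definition restrict_current :: "'a::metric_space functional1 \<Rightarrow> 'a set \<Rightarrow> 'a functional1" where
  "restrict_current T A f \<pi> = borel_extension T (\<lambda>x. indicator A x * f x) \<pi>"

text \<open>The pushforward $\phi_\#[\![u]\!]$ of the current $[\![u]\!](f,\pi) = \int u f \pi'\,dt$ on the
  line under a Lipschitz map $\phi$ defined on $K$, with $u = 0$ off $K$.  Since $\pi\circ\phi$ is
  only given on $K$, the derivative is taken within $K$: almost everywhere on $K$ this is the
  derivative of any Lipschitz extension of $\pi\circ\phi$ to the line.\<close>

definition chart_current ::
  "real set \<Rightarrow> (real \<Rightarrow> 'a::metric_space) \<Rightarrow> (real \<Rightarrow> int) \<Rightarrow> 'a functional1" where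
  "chart_current K \<phi> u f \<pi> =
     (LINT t:K|lebesgue.
        of_int (u t) * f (\<phi> t) * vector_derivative (\<lambda>s. \<pi> (\<phi> s)) (at t within K))"

abbreviation line_current :: "(real \<Rightarrow> int) \<Rightarrow> real functional1" where
  "line_current u \<equiv> chart_current UNIV (\<lambda>t. t) u"

definition integer_rectifiable0 :: "'a::metric_space functional0 \<Rightarrow> bool" where
  "integer_rectifiable0 T \<longleftrightarrow> current0 T \<and>
     (\<exists>(k :: nat \<Rightarrow> int) (x :: nat \<Rightarrow> 'a).
        \<forall>f. lip_b f \<longrightarrow> (\<lambda>h. of_int (k h) * point_current (x h) f) sums T f)"

definition integer_rectifiable1 :: "'a::metric_space functional1 \<Rightarrow> bool" where
  "integer_rectifiable1 T \<longleftrightarrow> current1 T \<and>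
     (\<exists>R\<in>sets borel. countably_rectifiable1 R \<and> emeasure (mass_measure T) (- R) = 0) \<and>
     (\<forall>A\<in>sets borel. hausdorff1 A = 0 \<longrightarrow> emeasure (mass_measure T) A = 0) \<and>
     (\<forall>\<phi> A. lip \<phi> \<longrightarrow> open A \<longrightarrow>
        (\<exists>u :: real \<Rightarrow> int. integrable lebesgue (\<lambda>t. real_of_int (u t)) \<and>
           (\<forall>f \<pi>. lip_b f \<longrightarrow> lip \<pi> \<longrightarrow>
              pushforward \<phi> (restrict_current T A) f \<pi> = line_current u f \<pi>)))"

definition integral_currents1 :: "'a::metric_space functional1 set" ("\<I>\<^sub>1") where
  "\<I>\<^sub>1 = {T. integer_rectifiable1 T \<and> integer_rectifiable0 (boundary T)}"

definition bi_lipschitz_on :: "real set \<Rightarrow> (real \<Rightarrow> 'a::metric_space) \<Rightarrow> bool" where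
  "bi_lipschitz_on K \<phi> \<longleftrightarrow>
     (\<exists>C>0. \<forall>s\<in>K. \<forall>t\<in>K. dist s t / C \<le> dist (\<phi> s) (\<phi> t) \<and> dist (\<phi> s) (\<phi> t) \<le> C * dist s t)"

text \<open>\<open>has_multiplicity T \<theta>\<close>: the current $T$ has an Ambrosio--Kirchheim rectifiable representation
  $T = \sum_i \phi_{i\#}[\![u_i]\!]$, $M(T) = \sum_i M(\phi_{i\#}[\![u_i]\!])$, by bi-Lipschitz charts
  $\phi_i$ on compact sets $K_i$ with pairwise disjoint images, and $\theta$ is the absolute value of
  its integer coefficient, transported to the space (and 0 off the images of the charts).  An integer
  rectifiable current determines $\theta$ up to $\mathcal H^1$-null sets, so this is a
  relation rather than a function of $T$.\<close>

definition has_multiplicity :: "'a::metric_space functional1 \<Rightarrow> ('a \<Rightarrow> nat) \<Rightarrow> bool" where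
  "has_multiplicity T \<theta> \<longleftrightarrow>
     (\<exists>(K :: nat \<Rightarrow> real set) (\<phi> :: nat \<Rightarrow> real \<Rightarrow> 'a) (u :: nat \<Rightarrow> real \<Rightarrow> int).
        (\<forall>i. compact (K i) \<and> bi_lipschitz_on (K i) (\<phi> i) \<and>
             integrable lebesgue (\<lambda>t. real_of_int (u i t)) \<and> (\<forall>t. t \<notin> K i \<longrightarrow> u i t = 0)) \<and>
        disjoint_family (\<lambda>i. \<phi> i ` K i) \<and>
        (\<forall>f \<pi>. lip_b f \<longrightarrow> lip \<pi> \<longrightarrow>
           (\<lambda>i. chart_current (K i) (\<phi> i) (u i) f \<pi>) sums T f \<pi>) \<and>
        (\<lambda>i. mass (chart_current (K i) (\<phi> i) (u i))) sums mass T \<and>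
        (\<forall>i. \<forall>t\<in>K i. \<theta> (\<phi> i t) = nat \<bar>u i t\<bar>) \<and>
        (\<forall>x. x \<notin> (\<Union>i. \<phi> i ` K i) \<longrightarrow> \<theta> x = 0))"


section \<open>Metric graph-like spaces\<close>

text \<open>The edges of the complex are $c_e : [0,\ell_e] \to G$ for $e \in E$.\<close>

definition complex_points :: "'e set \<Rightarrow> ('e \<Rightarrow> real) \<Rightarrow> ('e \<Rightarrow> real \<Rightarrow> 'a) \<Rightarrow> 'a set" where
  "complex_points E len c = (\<Union>e\<in>E. c e ` {0..len e})"

definition complex_vertices :: "'e set \<Rightarrow> ('e \<Rightarrow> real) \<Rightarrow> ('e \<Rightarrow> real \<Rightarrow> 'a) \<Rightarrow> 'a set" where
  "complex_vertices E len c = (\<Union>e\<in>E. {c e 0, c e (len e)})"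

text \<open>\<open>edge_chain E len c x y L\<close>: a finite concatenation of edge segments of total
  length \<open>L\<close> leads from \<open>x\<close> to \<open>y\<close>.  The infimum of such \<open>L\<close> is the length metric.\<close>

inductive edge_chain ::
  "'e set \<Rightarrow> ('e \<Rightarrow> real) \<Rightarrow> ('e \<Rightarrow> real \<Rightarrow> 'a) \<Rightarrow> 'a \<Rightarrow> 'a \<Rightarrow> real \<Rightarrow> bool"
  for E len c where
  chain_nil: "x \<in> complex_points E len c \<Longrightarrow> edge_chain E len c x x 0"
| chain_step: "e \<in> E \<Longrightarrow> s \<in> {0..len e} \<Longrightarrow> t \<in> {0..len e} \<Longrightarrow> edge_chain E len c (c e t) y L
    \<Longrightarrow> edge_chain E len c (c e s) y (\<bar>s - t\<bar> + L)"

text \<open>The third conjunct says that the intervals are glued along endpoints only, so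
  that distinct edges have disjoint interiors; loops and multiple edges are allowed.  The
  complete space is the completion of the complex because the complex is dense in it.\<close>

definition metric_graph_like ::
  "'e set \<Rightarrow> ('e \<Rightarrow> real) \<Rightarrow> ('e \<Rightarrow> real \<Rightarrow> 'a::complete_space) \<Rightarrow> bool" where
  "metric_graph_like E len c \<longleftrightarrow>
     countable E \<and> (\<forall>e\<in>E. 0 < len e) \<and>
     (\<forall>e\<in>E. \<forall>e'\<in>E. \<forall>s\<in>{0<..<len e}. \<forall>t\<in>{0..len e'}. c e s = c e' t \<longrightarrow> e = e' \<and> s = t) \<and>
     (\<forall>x\<in>complex_points E len c. \<forall>y\<in>complex_points E len c.
        (\<exists>L. edge_chain E len c x y L) \<and> dist x y = Inf {L. edge_chain E len c x y L}) \<and>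
     closure (complex_points E len c) = UNIV"

text \<open>A star neighbourhood of \<open>v\<close> with \<open>d\<close> arms, relative to the vertex set \<open>V\<close>.  The arms are
  isometric on $[0,\rho]$, and their outer endpoints are left out of the neighbourhood \<open>U\<close>, so that
  the components of $U \setminus \{v\}$ are the open segments $\gamma_i((0,\rho))$.\<close>

definition star_neighbourhood ::
  "'a::metric_space set \<Rightarrow> 'a \<Rightarrow> nat \<Rightarrow> 'a set \<Rightarrow> bool" where
  "star_neighbourhood V v d U \<longleftrightarrow>
     (\<exists>\<rho>>0. \<exists>\<gamma> :: nat \<Rightarrow> real \<Rightarrow> 'a.
        (\<forall>i<d. \<gamma> i 0 = v \<and> (\<forall>s\<in>{0..\<rho>}. \<forall>t\<in>{0..\<rho>}. dist (\<gamma> i s) (\<gamma> i t) = \<bar>s - t\<bar>)) \<and>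
        (\<forall>i<d. \<forall>j<d. i \<noteq> j \<longrightarrow> \<gamma> i ` {0..\<rho>} \<inter> \<gamma> j ` {0..\<rho>} = {v}) \<and>
        U = insert v (\<Union>i<d. \<gamma> i ` {0..<\<rho>}) \<and>
        v \<in> interior U \<and> U \<inter> closure V = {v})"

end

theory Submission
  imports Defs
begin

text \<open>
  The idea is to slice \<open>S\<close> by the distance to \<open>v\<close>.  Let \<open>P\<close> be the function that equals 1 at distance
  at most \<open>s\<close> from \<open>v\<close>, equals 0 at distance at least \<open>s + h\<close>, and is affine in the distance in
  between.  If \<open>s + h\<close> is smaller than the distance of \<open>v\<close> to every other point of the boundary, then
  \<open>\<partial>S(P) = m\<^sub>v\<close>.  On the other hand \<open>\<partial>S(P) = S(1, P)\<close>, and \<open>P\<close> is locally constant except on the shell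
  between the two radii, which the star cuts into \<open>d\<close> segments, one on each arm.  In the charts of a
  rectifiable representation, a change of variables to the distance turns \<open>S(1, P)\<close> into
  \<open>-(1/h) \<integral> W\<close> over \<open>[s, s + h]\<close>, where \<open>W(t) = \<sigma>\<^sub>1(t) + \<dots> + \<sigma>\<^sub>d(t)\<close> and \<open>\<sigma>\<^sub>j(t)\<close> is the integer
  coefficient of \<open>S\<close> at the point of the arm \<open>j\<close> at distance \<open>t\<close> from \<open>v\<close>, with the sign relative to
  the outward orientation of the arm
  (\<open>chart_current_ramp\<close> for a single chart, \<open>sums_integral_disjoint_unit\<close> for the sum over all charts).

  So all averages of \<open>W\<close> over small intervals are \<open>-m\<^sub>v\<close>, and hence \<open>W = -m\<^sub>v\<close> almost everywhere
  (\<open>negligible_interval_averages_neq\<close>).  Since the multiplicity is one almost everywhere on the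
  arms, almost every \<open>W(t)\<close> is a sum of \<open>d\<close> signs, so it has the parity of \<open>d\<close>.  One radius \<open>t\<close>
  at which both hold gives the theorem.

  The analysis behind the change of variables is the almost everywhere differentiability of a
  Lipschitz function on the line.  It is derived from the Vitali covering theorem, through
  Lebesgue's differentiation theorem, and from the Radon--Nikodym theorem.
\<close>

section \<open>Lebesgue differentiation on the line\<close>

text \<open>A Vitali argument.  Enclose the points of \<open>{f < p}\<close> in an open set \<open>T'\<close> that exceeds \<open>{f < p}\<close> by
  little for the measure with density \<open>\<bar>f - p\<bar>\<close>, and choose disjoint intervals inside \<open>T'\<close> that cover almost
  all bad points and on which the average of \<open>f\<close> exceeds \<open>q\<close>.  On their union \<open>U\<close>, the integral of \<open>f - p\<close> is at
  least \<open>(q - p) \<bar>U\<bar>\<close>; but only the points of \<open>T'\<close> outside \<open>{f < p}\<close> contribute positively to it,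
  so it is small.  Hence \<open>U\<close> is small.\<close>

lemma negligible_large_averages:
  fixes f :: "real \<Rightarrow> real"
  assumes f: "integrable lborel f" and "p < q"
  shows "negligible {x. f x < p \<and>
           (\<forall>\<delta>>0. \<exists>a b. a < b \<and> x \<in> {a..b} \<and> b - a < \<delta> \<and>
              q * (b - a) < (LINT y:{a..b}|lborel. f y))}" (is "negligible ?B")
proof -
  have [measurable]: "f \<in> borel_measurable borel"
    using f by auto
  have "negligible (?B \<inter> ball 0 (real n))" for n
    unfolding negligible_outer_le
  proof (intro allI impI)
    fix e :: real assume "e > 0"
    \<comment> \<open>the truncation to a ball makes the weight integrable, as outer regularity requires\<close>
    define w where "w = (\<lambda>x. \<bar>f x - p\<bar> * indicator (ball 0 (real n)) x)"
    define A where "A = {x. f x < p} \<inter> ball 0 (real n)"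
    have A [measurable]: "A \<in> sets borel"
      unfolding A_def by measurable
    have p_int: "set_integrable lborel (ball 0 (real n)) (\<lambda>x::real. p)"
      using emeasure_lborel_ball_finite[of "0::real" "real n"]
      by (auto simp: set_integrable_def intro!: integrable_real_indicator)
    have f_int: "set_integrable lborel T f" if "T \<in> sets borel" for T
      unfolding set_integrable_def using f that
      by (intro integrable_mult_indicator) auto
    have wint: "integrable lborel w"
    proof -
      have "set_integrable lborel (ball 0 (real n)) (\<lambda>x. \<bar>f x - p\<bar>)"
        by (intro set_integrable_abs set_integral_diff f_int p_int) auto
      then show ?thesis
        by (simp add: set_integrable_def w_def mult.commute)
    qed
    have w0: "w x \<ge> 0" for x
      by (simp add: w_def)
    define M where "M = density lborel (\<lambda>x. ennreal (w x))"
    have Mfin: "emeasure M T < \<infinity>" if "T \<in> sets borel" for T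
    proof -
      have "emeasure M T \<le> emeasure M UNIV"
        by (intro emeasure_mono) (auto simp: M_def)
      also have "\<dots> = ennreal (integral\<^sup>L lborel w)"
        using wint w0 by (simp add: M_def emeasure_density nn_integral_eq_integral)
      finally show ?thesis by (simp add: le_less_trans)
    qed
    have "emeasure M A = (INF U\<in>{U. A \<subseteq> U \<and> open U}. emeasure M U)"
      using Mfin[of UNIV] by (intro outer_regular) (auto simp: M_def)
    moreover have "emeasure M A < emeasure M A + ennreal (e * (q - p))"
      using Mfin[OF A] \<open>e > 0\<close> \<open>p < q\<close> by simp
    ultimately have "(INF U\<in>{U. A \<subseteq> U \<and> open U}. emeasure M U)
        < emeasure M A + ennreal (e * (q - p))"
      by simp
    then obtain T where T: "open T" "A \<subseteq> T"
        "emeasure M T < emeasure M A + ennreal (e * (q - p))"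
      unfolding Inf_less_iff by auto
    define T' where "T' = T \<inter> ball 0 (real n)"
    have T': "open T'" "A \<subseteq> T'" "T' \<subseteq> T" "T' \<subseteq> ball 0 (real n)"
      using T by (auto simp: T'_def A_def)
    have [measurable]: "T' \<in> sets borel" using T' by auto
    have small: "(LINT x:(T' - A)|lborel. \<bar>f x - p\<bar>) \<le> e * (q - p)"
    proof -
      have "emeasure M A + emeasure M (T' - A) = emeasure M T'"
        using T' by (subst plus_emeasure) (auto simp: M_def Un_absorb1)
      also have "\<dots> \<le> emeasure M T"
        using T T' by (intro emeasure_mono) (auto simp: M_def)
      also have "\<dots> \<le> emeasure M A + ennreal (e * (q - p))"
        using T by simp
      finally have "emeasure M (T' - A) \<le> ennreal (e * (q - p))"
        using Mfin[OF A] by (auto simp: ennreal_add_left_cancel_le)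
      also have "emeasure M (T' - A) = (\<integral>\<^sup>+x. ennreal (indicator (T' - A) x * \<bar>f x - p\<bar>) \<partial>lborel)"
        unfolding M_def using T'
        by (subst emeasure_density)
          (auto simp: w_def indicator_def intro!: nn_integral_cong)
      also have "\<dots> = ennreal (LINT x:(T' - A)|lborel. \<bar>f x - p\<bar>)"
        unfolding set_lebesgue_integral_def real_scaleR_def
      proof (intro nn_integral_eq_integral AE_I2)
        have "integrable lborel (\<lambda>x. indicator (T' - A) x *\<^sub>R w x)"
          using wint by (intro integrable_mult_indicator) auto
        also have "(\<lambda>x. indicator (T' - A) x *\<^sub>R w x)
            = (\<lambda>x. indicator (T' - A) x * \<bar>f x - p\<bar>)"
          using T' by (auto simp: w_def indicator_def fun_eq_iff)
        finally show "integrable lborel (\<lambda>x. indicator (T' - A) x * \<bar>f x - p\<bar>)" .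
      qed auto
      finally show ?thesis
        using \<open>e > 0\<close> \<open>p < q\<close> by simp
    qed
    let ?K = "{(c, r). 0 < r \<and> cball c r \<subseteq> T' \<and> q * measure lborel (cball c r) < (LINT y:cball c r|lborel. f y)}"
    have Vitali: "\<exists>i. i \<in> ?K \<and> x \<in> cball (fst i) (snd i) \<and> snd i < d"
      if x: "x \<in> ?B \<inter> ball 0 (real n)" and "0 < d" for x d
    proof -
      from x have "x \<in> T'"
        using T' by (auto simp: A_def)
      with T'(1) obtain e where e: "e > 0" "ball x e \<subseteq> T'"
        by (rule openE)
      obtain a b where ab: "a < b" "x \<in> {a..b}" "b - a < min d e"
        "q * (b - a) < (LINT y:{a..b}|lborel. f y)"
      proof -
        have "\<forall>\<delta>>0. \<exists>a b. a < b \<and> x \<in> {a..b} \<and> b - a < \<delta> \<and>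
              q * (b - a) < (LINT y:{a..b}|lborel. f y)"
          using x by blast
        moreover have "min d e > 0"
          using \<open>0 < d\<close> \<open>e > 0\<close> by simp
        ultimately show ?thesis
          using that by blast
      qed
      have ab_cball: "cball ((a + b) / 2) ((b - a) / 2) = {a..b}"
        by (simp add: cball_eq_atLeastAtMost field_simps)
      have "{a..b} \<subseteq> ball x e"
        using ab by (auto simp: dist_real_def)
      with e have sub: "{a..b} \<subseteq> T'"
        by blast
      have "((a + b) / 2, (b - a) / 2) \<in> ?K"
        unfolding mem_Collect_eq case_prod_conv ab_cball using sub ab by simp
      moreover have "x \<in> cball (fst ((a + b) / 2, (b - a) / 2)) (snd ((a + b) / 2, (b - a) / 2))"
        unfolding fst_conv snd_conv ab_cball by (rule ab(2))
      moreover have "snd ((a + b) / 2, (b - a) / 2) < d"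
        using ab by simp
      ultimately show ?thesis
        by blast
    qed
    have pos: "0 < snd i" if "i \<in> ?K" for i
      using that by auto
    obtain C where C: "countable C" "C \<subseteq> ?K"
      "pairwise (\<lambda>i j. disjnt (cball (fst i) (snd i)) (cball (fst j) (snd j))) C"
      "negligible (?B \<inter> ball 0 (real n) - (\<Union>i\<in>C. cball (fst i) (snd i)))"
      by (rule Vitali_covering_theorem_cballs[OF pos Vitali])
    have fin: "measure lebesgue (\<Union>i\<in>C'. cball (fst i) (snd i)) \<le> e"
      if "finite C'" "C' \<subseteq> C" for C'
    proof -
      let ?U = "\<Union>i\<in>C'. cball (fst i) (snd i)"
      have K: "cball (fst i) (snd i) \<subseteq> T'"
          "q * measure lborel (cball (fst i) (snd i)) \<le> (LINT y:cball (fst i) (snd i)|lborel. f y)"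
        if "i \<in> C'" for i
      proof -
        have "i \<in> ?K"
          using that \<open>C' \<subseteq> C\<close> C(2) by blast
        then have "cball (fst i) (snd i) \<subseteq> T' \<and>
            q * measure lborel (cball (fst i) (snd i)) < (LINT y:cball (fst i) (snd i)|lborel. f y)"
          by (simp only: mem_Collect_eq case_prod_unfold)
        then show "cball (fst i) (snd i) \<subseteq> T'"
          "q * measure lborel (cball (fst i) (snd i)) \<le> (LINT y:cball (fst i) (snd i)|lborel. f y)"
          by (blast, linarith)
      qed
      have U: "?U \<subseteq> T'" "?U \<in> sets borel"
        using K(1) \<open>finite C'\<close> by (blast, auto)
      have dis: "disjoint_family_on (\<lambda>i. cball (fst i) (snd i)) C'"
        using C(3) that unfolding disjoint_family_on_def pairwise_def disjnt_def by blast
      have "emeasure lborel ?U \<le> emeasure lborel (ball (0::real) (real n))"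
        using U T' by (intro emeasure_mono) auto
      then have Ufin: "emeasure lborel ?U < \<infinity>"
        using emeasure_lborel_ball_finite less_le_trans le_less_trans by blast
      have "measure lborel ?U = (\<Sum>i\<in>C'. measure lborel (cball (fst i) (snd i)))"
        using that dis
        by (intro measure_finite_Union) (use emeasure_lborel_cball_finite in \<open>auto simp: less_top\<close>)
      then have "q * measure lborel ?U = (\<Sum>i\<in>C'. q * measure lborel (cball (fst i) (snd i)))"
        by (simp add: sum_distrib_left)
      also have "\<dots> \<le> (\<Sum>i\<in>C'. LINT y:cball (fst i) (snd i)|lborel. f y)"
        by (intro sum_mono K)
      also have "\<dots> = (LINT y:?U|lborel. f y)"
        using that dis by (intro set_integral_finite_Union[symmetric] f_int) auto
      finally have 1: "q * measure lborel ?U \<le> (LINT y:?U|lborel. f y)" .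
      have "(LINT y:?U|lborel. f y) - p * measure lborel ?U = (LINT y:?U|lborel. f y - p)"
      proof -
        have "set_integrable lborel ?U (\<lambda>_. p)"
          using U Ufin by (auto simp: set_integrable_def)
        from set_integral_diff(2)[OF f_int[OF U(2)] this] show ?thesis
          by (simp add: set_lebesgue_integral_def mult.commute)
      qed
      also have "\<dots> \<le> (LINT y:(T' - A)|lborel. \<bar>f y - p\<bar>)"
        unfolding set_lebesgue_integral_def real_scaleR_def
      proof (intro integral_mono)
        have "integrable lborel (\<lambda>x. indicator (T' - A) x *\<^sub>R w x)"
          using wint by (intro integrable_mult_indicator) auto
        also have "(\<lambda>x. indicator (T' - A) x *\<^sub>R w x)
            = (\<lambda>x. indicator (T' - A) x * \<bar>f x - p\<bar>)"
          using T' by (auto simp: w_def indicator_def fun_eq_iff)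
        finally show "integrable lborel (\<lambda>x. indicator (T' - A) x * \<bar>f x - p\<bar>)" .
        have "set_integrable lborel ?U (\<lambda>x. f x - p)"
          using U Ufin by (intro set_integral_diff f_int) (auto simp: set_integrable_def)
        then show "integrable lborel (\<lambda>x. indicator ?U x * (f x - p))"
          by (simp add: set_integrable_def)
        show "indicator ?U x * (f x - p) \<le> indicator (T' - A) x * \<bar>f x - p\<bar>" for x
        proof (cases "x \<in> ?U")
          case True
          then have "x \<in> T'"
            using U(1) by blast
          then show ?thesis
            using True T'(4) by (auto simp: indicator_def A_def)
        qed (simp add: indicator_def)
      qed
      finally have "(q - p) * measure lborel ?U \<le> e * (q - p)"
        using 1 small by (simp add: algebra_simps)
      then have "measure lborel ?U \<le> e"
        using \<open>p < q\<close> by (simp add: mult.commute)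
      then show ?thesis using U by (simp add: measure_completion)
    qed
    let ?V = "\<Union>i\<in>C. cball (fst i) (snd i)"
    have V: "?V \<in> lmeasurable \<and> measure lebesgue ?V \<le> e"
    proof -
      have "cball (fst i) (snd i) \<in> lmeasurable" for i :: "real \<times> real"
        by simp
      then show ?thesis
        using fmeasurable_UN_bound[OF C(1), of _ lebesgue e] measure_UN_bound[OF C(1), of _ lebesgue e] fin
        by (metis (no_types, lifting))
    qed
    let ?R = "?B \<inter> ball 0 (real n) - ?V"
    have "?V \<union> ?R \<in> lmeasurable"
      using conjunct1[OF V] negligible_imp_measurable[OF C(4)] by (rule fmeasurable.Un)
    moreover have "measure lebesgue (?V \<union> ?R) \<le> e"
    proof -
      have "measure lebesgue (?V \<union> ?R) = measure lebesgue ?V"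
        using fmeasurableD[OF conjunct1[OF V]] C(4)[unfolded negligible_iff_null_sets]
        by (rule measure_Un_null_set)
      also have "\<dots> \<le> e"
        using V by (rule conjunct2)
      finally show ?thesis .
    qed
    ultimately show "\<exists>T. ?B \<inter> ball 0 (real n) \<subseteq> T \<and> T \<in> lmeasurable \<and> measure lebesgue T \<le> e"
      by (intro exI[of _ "?V \<union> ?R"] conjI) (rule Un_Diff_cancel[THEN equalityD2, THEN order_trans[OF Un_upper2]])
  qed
  then have "negligible (\<Union>n. ?B \<inter> ball 0 (real n))"
    by (intro negligible_countable_Union) auto
  moreover have "?B \<subseteq> (\<Union>n. ?B \<inter> ball 0 (real n))"
    using reals_Archimedean2 by auto
  ultimately show ?thesis
    by (rule negligible_subset)
qed

text \<open>The intervals need not be centred at \<open>x\<close>; the one-sided ones give one-sided difference quotients.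
  The upper bound on the averages comes from \<open>negligible_large_averages\<close> for \<open>f\<close>, the lower bound from
  the same lemma for \<open>-f\<close>, over all pairs of rationals \<open>p < q\<close>.\<close>

lemma lebesgue_differentiation_real:
  fixes f :: "real \<Rightarrow> real"
  assumes f: "integrable lborel f"
  shows "negligible {x. \<not> (\<forall>\<epsilon>>0. \<exists>\<delta>>0. \<forall>a b. a \<le> b \<longrightarrow> x \<in> {a..b} \<longrightarrow> b - a < \<delta> \<longrightarrow>
           \<bar>(LINT y:{a..b}|lborel. f y) - f x * (b - a)\<bar> \<le> \<epsilon> * (b - a))}" (is "negligible ?N")
proof -
  define B where "B = (\<lambda>(g :: real \<Rightarrow> real) p q. {x. g x < p \<and>
           (\<forall>\<delta>>0. \<exists>a b. a < b \<and> x \<in> {a..b} \<and> b - a < \<delta> \<and>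
              q * (b - a) < (LINT y:{a..b}|lborel. g y))})"
  define P where "P = {(p, q). p \<in> \<rat> \<and> q \<in> \<rat> \<and> p < (q :: real)}"
  have "countable P"
    by (rule countable_subset[of _ "\<rat> \<times> \<rat>"]) (auto simp: P_def countable_rat)
  moreover have "negligible (B f p q \<union> B (\<lambda>x. - f x) p q)" if "(p, q) \<in> P" for p q
    unfolding B_def using that f
    by (intro negligible_Un negligible_large_averages) (auto simp: P_def)
  ultimately have "negligible (\<Union>(p, q)\<in>P. B f p q \<union> B (\<lambda>x. - f x) p q)"
    by (intro negligible_Union_nat negligible_countable_Union) auto
  moreover have "?N \<subseteq> (\<Union>(p, q)\<in>P. B f p q \<union> B (\<lambda>x. - f x) p q)"
  proof
    fix x assume "x \<in> ?N"
    show "x \<in> (\<Union>(p, q)\<in>P. B f p q \<union> B (\<lambda>x. - f x) p q)"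
    proof (rule ccontr)
      assume x: "x \<notin> (\<Union>(p, q)\<in>P. B f p q \<union> B (\<lambda>x. - f x) p q)"
      have upper: "\<exists>\<delta>>0. \<forall>a b. a \<le> b \<longrightarrow> x \<in> {a..b} \<longrightarrow> b - a < \<delta> \<longrightarrow>
           (LINT y:{a..b}|lborel. g y) \<le> (g x + \<epsilon>) * (b - a)"
        if "\<epsilon> > 0" and g: "g = f \<or> g = (\<lambda>x. - f x)" for \<epsilon> g
      proof -
        obtain p where p: "p \<in> \<rat>" "g x < p" "p < g x + \<epsilon>"
          using Rats_dense_in_real[of "g x" "g x + \<epsilon>"] \<open>\<epsilon> > 0\<close> by auto
        obtain q where q: "q \<in> \<rat>" "p < q" "q < g x + \<epsilon>"
          using Rats_dense_in_real[of p "g x + \<epsilon>"] p by auto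
        have "(p, q) \<in> P"
          using p q by (simp add: P_def)
        then have "x \<notin> B g p q"
          using x g by blast
        then obtain \<delta> where \<delta>: "\<delta> > 0"
          "\<And>a b. a < b \<Longrightarrow> x \<in> {a..b} \<Longrightarrow> b - a < \<delta> \<Longrightarrow>
             (LINT y:{a..b}|lborel. g y) \<le> q * (b - a)"
          using p(2) unfolding B_def mem_Collect_eq not_less[symmetric] by blast
        have "(LINT y:{a..b}|lborel. g y) \<le> (g x + \<epsilon>) * (b - a)"
          if ab: "a \<le> b" "x \<in> {a..b}" "b - a < \<delta>" for a b
        proof (cases "a = b")
          case True
          then show ?thesis
            using AE_lborel_singleton[of b]
            by (auto simp: set_lebesgue_integral_def indicator_def intro!: eq_refl integral_eq_zero_AE)
        next
          case False
          then have "(LINT y:{a..b}|lborel. g y) \<le> q * (b - a)"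
            using ab by (intro \<delta>(2)) auto
          also have "\<dots> \<le> (g x + \<epsilon>) * (b - a)"
            using q ab by (intro mult_right_mono) auto
          finally show ?thesis .
        qed
        then show ?thesis
          using \<delta>(1) by blast
      qed
      have "\<exists>\<delta>>0. \<forall>a b. a \<le> b \<longrightarrow> x \<in> {a..b} \<longrightarrow> b - a < \<delta> \<longrightarrow>
           \<bar>(LINT y:{a..b}|lborel. f y) - f x * (b - a)\<bar> \<le> \<epsilon> * (b - a)" if "\<epsilon> > 0" for \<epsilon>
      proof -
        obtain \<delta>1 where 1: "\<delta>1 > 0" "\<And>a b. a \<le> b \<Longrightarrow> x \<in> {a..b} \<Longrightarrow> b - a < \<delta>1 \<Longrightarrow>
           (LINT y:{a..b}|lborel. f y) \<le> (f x + \<epsilon>) * (b - a)"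
          using upper[OF \<open>\<epsilon> > 0\<close>, of f] by blast
        obtain \<delta>2 where 2: "\<delta>2 > 0" "\<And>a b. a \<le> b \<Longrightarrow> x \<in> {a..b} \<Longrightarrow> b - a < \<delta>2 \<Longrightarrow>
           (LINT y:{a..b}|lborel. - f y) \<le> (- f x + \<epsilon>) * (b - a)"
          using upper[OF \<open>\<epsilon> > 0\<close>, of "\<lambda>x. - f x"] by blast
        have "\<bar>(LINT y:{a..b}|lborel. f y) - f x * (b - a)\<bar> \<le> \<epsilon> * (b - a)"
          if "a \<le> b" "x \<in> {a..b}" "b - a < min \<delta>1 \<delta>2" for a b
        proof -
          have "(LINT y:{a..b}|lborel. - f y) = - (LINT y:{a..b}|lborel. f y)"
            by (simp add: set_lebesgue_integral_def)
          then show ?thesis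
            using 1(2)[of a b] 2(2)[of a b] that by (auto simp: algebra_simps abs_le_iff)
        qed
        then show ?thesis
          using 1(1) 2(1) by (intro exI[of _ "min \<delta>1 \<delta>2"]) auto
      qed
      with \<open>x \<in> ?N\<close> show False
        by blast
    qed
  qed
  ultimately show ?thesis
    by (rule negligible_subset)
qed

section \<open>Lipschitz functions are differentiable almost everywhere\<close>

text \<open>Such an \<open>F\<close> is a homeomorphism of the line that preserves null sets.  So \<open>A \<mapsto> \<bar>F(A)\<bar>\<close> is an
  absolutely continuous measure, and \<open>F\<close> is an indefinite integral of its Radon--Nikodym density, to
  which Lebesgue's differentiation theorem applies.\<close>

lemma negligible_nondifferentiable_bilipschitz:
  fixes F :: "real \<Rightarrow> real"
  assumes F: "\<And>x y. x \<le> y \<Longrightarrow> y - x \<le> F y - F x \<and> F y - F x \<le> M * (y - x)"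
  shows "negligible {x. \<not> F field_differentiable (at x)}"
proof -
  have F_le_iff: "F x \<le> F y \<longleftrightarrow> x \<le> y" for x y
    using F[of x y] F[of y x] by linarith
  have "inj F"
    by (rule injI) (metis F_le_iff order_antisym order_refl)
  have F_lip: "\<bar>F x - F y\<bar> \<le> M * \<bar>x - y\<bar>" for x y
    using F[of x y] F[of y x] by (cases "x \<le> y") (auto simp: abs_if)
  have "M-lipschitz_on A F" for A
    using F[of 0 1] F_lip by (intro lipschitz_onI) (auto simp: dist_real_def)
  then have cont_F: "continuous_on A F" for A
    by (rule lipschitz_on_continuous_on)
  have "\<exists>x. F x = y" for y
  proof -
    let ?b = "\<bar>y - F 0\<bar>"
    have "F (- ?b) \<le> y" "y \<le> F ?b"
      using F[of "- ?b" 0] F[of 0 ?b] by auto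
    then show ?thesis
      using IVT'[of F "- ?b" y ?b] cont_F by auto
  qed
  then have "surj F"
    by (metis surjI)
  define G where "G = inv F"
  have FG: "F (G y) = y" and GF: "G (F x) = x" for x y
    using \<open>inj F\<close> \<open>surj F\<close> by (simp_all add: G_def surj_f_inv_f)
  have G_le: "\<bar>G x - G y\<bar> \<le> \<bar>x - y\<bar>" for x y
    using F[of "G x" "G y"] F[of "G y" "G x"] unfolding FG by linarith
  have "1-lipschitz_on UNIV G"
    using G_le by (intro lipschitz_onI) (auto simp: dist_real_def)
  then have "continuous_on UNIV G"
    by (rule lipschitz_on_continuous_on)
  then have [measurable]: "G \<in> borel_measurable borel"
    by (rule borel_measurable_continuous_onI)
  have "negligible {x \<in> {- real n<..<real n}. \<not> F field_differentiable (at x)}" for n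
  proof -
    \<comment> \<open>the measure \<open>A \<mapsto> \<bar>F(A)\<bar>\<close>, cut off to \<open>[-n, n]\<close> to make it finite\<close>
    define N where "N = distr (density lborel (indicator {F (- real n)..F (real n)})) borel G"
    have N: "emeasure N A = emeasure lborel ({F (- real n)..F (real n)} \<inter> G -` A)"
      if "A \<in> sets borel" for A
    proof -
      have [measurable]: "G -` A \<in> sets borel"
        using that measurable_sets_borel[of G borel A] by simp
      have "emeasure N A = (\<integral>\<^sup>+x. indicator {F (- real n)..F (real n)} x * indicator (G -` A) x \<partial>lborel)"
        using that by (simp add: N_def emeasure_distr emeasure_density)
      also have "\<dots> = (\<integral>\<^sup>+x. indicator ({F (- real n)..F (real n)} \<inter> G -` A) x \<partial>lborel)"
        by (simp add: indicator_inter_arith)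
      finally show ?thesis
        by simp
    qed
    have "sets N = sets lborel"
      by (simp add: N_def)
    have "emeasure N (space N) < \<infinity>"
      using F_le_iff by (simp add: N N_def[THEN arg_cong, of space] emeasure_lborel_Icc_eq)
    then interpret N: finite_measure N
      by (intro finite_measureI) auto
    have "absolutely_continuous lborel N"
      unfolding absolutely_continuous_def
    proof
      fix A :: "real set" assume A: "A \<in> null_sets lborel"
      then have "A \<in> sets borel"
        by (auto dest: null_setsD2)
      then have [measurable]: "G -` A \<in> sets borel"
        using measurable_sets_borel[of G borel A] by simp
      have "negligible A"
        using A
        by (simp add: negligible_iff_null_sets null_sets_completionI)
      then have "negligible (F ` A)"
        using F_lip by (intro negligible_locally_Lipschitz_image) (auto intro!: exI[of _ UNIV] exI[of _ M])
      moreover have "F ` A = G -` A"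
        using FG GF by (auto simp: image_iff) (metis FG)
      ultimately have "emeasure lborel (G -` A) = 0"
        by (simp add: negligible_iff_null_sets null_sets_completion_iff null_setsD1 null_setsD2)
      moreover have "emeasure N A \<le> emeasure lborel (G -` A)"
        by (simp add: N \<open>A \<in> sets borel\<close> emeasure_mono)
      ultimately show "A \<in> null_sets N"
        using \<open>A \<in> sets borel\<close> \<open>sets N = sets lborel\<close> by (auto intro!: null_setsI)
    qed
    then obtain D where D [measurable]: "D \<in> borel_measurable lborel"
        and D_RN: "AE x in lborel. RN_deriv lborel N x = ennreal (D x)" and D0: "\<And>x. 0 \<le> D x"
      using sigma_finite_measure.real_RN_deriv[OF lborel.sigma_finite_measure_axioms, of N] N.finite_measure_axioms \<open>sets N = sets lborel\<close> by metis
    have "density lborel (RN_deriv lborel N) = N"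
      by (rule sigma_finite_measure.density_RN_deriv[OF lborel.sigma_finite_measure_axioms]) fact+
    moreover have "density lborel (RN_deriv lborel N) = density lborel (\<lambda>x. ennreal (D x))"
      using D_RN by (intro density_cong) auto
    ultimately have N_dens: "N = density lborel (\<lambda>x. ennreal (D x))"
      by simp
    have "integrable lborel D"
    proof (rule integrableI_nonneg)
      have "(\<integral>\<^sup>+x. ennreal (D x) \<partial>lborel) = emeasure N UNIV"
        by (simp add: N_dens emeasure_density)
      then show "(\<integral>\<^sup>+x. ennreal (D x) \<partial>lborel) < \<infinity>"
        by (metis N.emeasure_finite infinity_ennreal_def less_top)
    qed (use D0 in auto)
    have D_int: "(LINT y:{a..b}|lborel. D y) = F b - F a" if "- real n \<le> a" "a \<le> b" "b \<le> real n" for a b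
    proof -
      have "{F (- real n)..F (real n)} \<inter> G -` {a..b} = {F a..F b}"
      proof -
        have "G y \<in> {a..b} \<longleftrightarrow> y \<in> {F a..F b}" for y
          using F_le_iff[of a "G y"] F_le_iff[of "G y" b] by (simp add: FG)
        moreover have "{F a..F b} \<subseteq> {F (- real n)..F (real n)}"
          using F_le_iff[of "- real n" a] F_le_iff[of b "real n"] that by auto
        ultimately show ?thesis
          by blast
      qed
      then have "ennreal (F b - F a) = emeasure N {a..b}"
        using that F_le_iff by (simp add: N)
      also have "\<dots> = (\<integral>\<^sup>+x. ennreal (indicator {a..b} x * D x) \<partial>lborel)"
        by (auto simp: N_dens emeasure_density indicator_def intro!: nn_integral_cong)
      also have "\<dots> = ennreal (LINT y:{a..b}|lborel. D y)"
        unfolding set_lebesgue_integral_def real_scaleR_def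
        using integrable_mult_indicator[of "{a..b}" lborel D] \<open>integrable lborel D\<close> D0
        by (intro nn_integral_eq_integral) auto
      finally show ?thesis
        using that F_le_iff D0
        by (subst (asm) ennreal_inj) (auto simp: set_lebesgue_integral_def intro!: integral_nonneg_AE)
    qed
    have "F field_differentiable (at x)"
      if x: "x \<in> {- real n<..<real n}" and
        leb: "\<forall>\<epsilon>>0. \<exists>\<delta>>0. \<forall>a b. a \<le> b \<longrightarrow> x \<in> {a..b} \<longrightarrow> b - a < \<delta> \<longrightarrow>
           \<bar>(LINT y:{a..b}|lborel. D y) - D x * (b - a)\<bar> \<le> \<epsilon> * (b - a)" for x
    proof -
      have "(F has_field_derivative D x) (at x)"
        unfolding has_field_derivative_iff Lim_at
      proof (intro allI impI)
        fix e :: real assume "e > 0"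
        then obtain \<delta> where "\<delta> > 0" and \<delta>: "\<And>a b. a \<le> b \<Longrightarrow> x \<in> {a..b} \<Longrightarrow> b - a < \<delta> \<Longrightarrow>
           \<bar>(LINT y:{a..b}|lborel. D y) - D x * (b - a)\<bar> \<le> (e / 2) * (b - a)"
          using leb half_gt_zero by blast
        have quotient: "\<bar>F b - F a - D x * (b - a)\<bar> \<le> (e / 2) * (b - a)"
          if "a \<le> b" "x \<in> {a..b}" "b - a < \<delta>" "- real n \<le> a" "b \<le> real n" for a b
          using \<delta>[of a b] D_int[of a b] that by simp
        have "\<bar>(F y - F x) / (y - x) - D x\<bar> < e"
          if y: "y \<noteq> x" "\<bar>y - x\<bar> < min \<delta> (real n - \<bar>x\<bar>)" for y
        proof -
          have "\<bar>F y - F x - D x * (y - x)\<bar> \<le> (e / 2) * \<bar>y - x\<bar>"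
          proof (cases "x \<le> y")
            case True
            then show ?thesis using quotient[of x y] y by auto
          next
            case False
            have "\<bar>F y - F x - D x * (y - x)\<bar> = \<bar>F x - F y - D x * (x - y)\<bar>"
              by (simp add: abs_if algebra_simps)
            then show ?thesis using quotient[of y x] False y by auto
          qed
          then have "\<bar>F y - F x - D x * (y - x)\<bar> / \<bar>y - x\<bar> \<le> e / 2"
            using y by (simp add: divide_le_eq)
          moreover have "\<bar>(F y - F x) / (y - x) - D x\<bar> = \<bar>F y - F x - D x * (y - x)\<bar> / \<bar>y - x\<bar>"
            using y by (simp add: abs_divide[symmetric] diff_divide_distrib)
          ultimately show ?thesis
            using \<open>e > 0\<close> by linarith
        qed
        moreover have "min \<delta> (real n - \<bar>x\<bar>) > 0"
          using \<open>\<delta> > 0\<close> x by auto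
        ultimately show "\<exists>d>0. \<forall>y. 0 < dist y x \<and> dist y x < d \<longrightarrow>
            dist ((F y - F x) / (y - x)) (D x) < e"
          by (intro exI[of _ "min \<delta> (real n - \<bar>x\<bar>)"]) (auto simp: dist_real_def)
      qed
      then show ?thesis
        by (auto simp: field_differentiable_def)
    qed
    then show ?thesis
      by (intro negligible_subset[OF lebesgue_differentiation_real[OF \<open>integrable lborel D\<close>]]) blast
  qed
  then have "negligible (\<Union>n. {x \<in> {- real n<..<real n}. \<not> F field_differentiable (at x)})"
    by (intro negligible_countable_Union) auto
  moreover have "{x. \<not> F field_differentiable (at x)} \<subseteq>
      (\<Union>n. {x \<in> {- real n<..<real n}. \<not> F field_differentiable (at x)})"
  proof
    fix x assume x: "x \<in> {x. \<not> F field_differentiable (at x)}"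
    obtain n where "\<bar>x\<bar> < real n"
      using reals_Archimedean2 by blast
    with x have "x \<in> {x \<in> {- real n<..<real n}. \<not> F field_differentiable (at x)}"
      by (auto simp: abs_less_iff)
    then show "x \<in> (\<Union>n. {x \<in> {- real n<..<real n}. \<not> F field_differentiable (at x)})"
      by blast
  qed
  ultimately show ?thesis
    by (rule negligible_subset)
qed

text \<open>Adding a steep linear function makes a Lipschitz function increasing and bi-Lipschitz.\<close>

lemma negligible_nondifferentiable_lipschitz:
  fixes g :: "real \<Rightarrow> real"
  assumes g: "L-lipschitz_on UNIV g"
  shows "negligible {x. \<not> g field_differentiable (at x)}"
proof -
  have bound: "\<bar>g y - g x\<bar> \<le> L * \<bar>y - x\<bar>" for x y
    using lipschitz_onD[OF g, of y x] by (simp add: dist_real_def)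
  define F where "F = (\<lambda>x. g x + (L + 1) * x)"
  have "negligible {x. \<not> F field_differentiable (at x)}"
  proof (rule negligible_nondifferentiable_bilipschitz)
    fix x y :: real assume "x \<le> y"
    then show "y - x \<le> F y - F x \<and> F y - F x \<le> (2 * L + 1) * (y - x)"
      using bound[of x y] by (auto simp: F_def algebra_simps abs_le_iff)
  qed
  moreover have "g field_differentiable (at x)" if "F field_differentiable (at x)" for x
  proof -
    have "(\<lambda>x. F x - (L + 1) * x) field_differentiable (at x)"
      using that by (intro derivative_intros) auto
    then show ?thesis by (simp add: F_def)
  qed
  ultimately show ?thesis
    by (elim negligible_subset) blast
qed

text \<open>McShane's formula.\<close>

lemma lipschitz_extension_real:
  fixes f :: "'a::metric_space \<Rightarrow> real"
  assumes f: "L-lipschitz_on A f"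
  obtains g where "L-lipschitz_on UNIV g" "\<And>x. x \<in> A \<Longrightarrow> g x = f x"
proof (cases "A = {}")
  case True
  with f show ?thesis
    by (intro that[of "\<lambda>_. 0"]) (auto simp: lipschitz_on_def)
next
  case False
  have "L \<ge> 0"
    using f by (rule lipschitz_on_nonneg)
  define g where "g = (\<lambda>x. INF a\<in>A. f a + L * dist x a)"
  obtain a0 where "a0 \<in> A" using False by blast
  have bdd: "bdd_below ((\<lambda>a. f a + L * dist x a) ` A)" for x
  proof (rule bdd_belowI2)
    fix a assume "a \<in> A"
    have "f a0 - f a \<le> L * dist a0 a"
      using lipschitz_onD[OF f \<open>a0 \<in> A\<close> \<open>a \<in> A\<close>] by (simp add: dist_real_def)
    also have "\<dots> \<le> L * (dist x a0 + dist x a)"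
      using \<open>L \<ge> 0\<close> dist_triangle[of a0 a x] by (intro mult_left_mono) (auto simp: dist_commute)
    finally show "f a0 - L * dist x a0 \<le> f a + L * dist x a"
      by (simp add: algebra_simps)
  qed
  have step: "g x \<le> g y + L * dist x y" for x y
  proof -
    have "g x - L * dist x y \<le> f a + L * dist y a" if "a \<in> A" for a
    proof -
      have "g x \<le> f a + L * dist x a"
        unfolding g_def using bdd that by (rule cINF_lower)
      also have "\<dots> \<le> f a + L * (dist x y + dist y a)"
        using \<open>L \<ge> 0\<close> dist_triangle[of x a y] by (simp add: mult_left_mono)
      finally show ?thesis by (simp add: algebra_simps)
    qed
    then have "g x - L * dist x y \<le> g y"
      unfolding g_def using False by (intro cINF_greatest) auto
    then show ?thesis by simp
  qed
  have "g x = f x" if "x \<in> A" for x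
  proof (rule antisym)
    show "g x \<le> f x"
      unfolding g_def using bdd that by (auto intro: cINF_lower2)
    show "f x \<le> g x"
      unfolding g_def
    proof (rule cINF_greatest[OF False])
      fix a assume "a \<in> A"
      then show "f x \<le> f a + L * dist x a"
        using lipschitz_onD[OF f \<open>x \<in> A\<close>, of a] by (simp add: dist_real_def)
    qed
  qed
  moreover have "L-lipschitz_on UNIV g"
  proof (rule lipschitz_onI)
    show "dist (g x) (g y) \<le> L * dist x y" for x y
      using step[of x y] step[of y x] by (simp add: dist_real_def abs_le_iff dist_commute)
  qed fact
  ultimately show ?thesis
    using that by blast
qed

text \<open>A bounded Borel function that is defined everywhere spares measurability questions about the set
  where \<open>g\<close> is differentiable.  It is the limit of the difference quotients for the steps \<open>1/(n+1)\<close>,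
  clipped to \<open>[-L, L]\<close>, because \<open>lim\<close> may take any value where the quotients diverge.\<close>

lemma lipschitz_borel_derivative:
  fixes g :: "real \<Rightarrow> real"
  assumes g: "L-lipschitz_on UNIV g"
  obtains D where "D \<in> borel_measurable borel" "\<And>x. \<bar>D x\<bar> \<le> L"
    "negligible {x. \<not> (g has_real_derivative D x) (at x)}"
proof
  have "L \<ge> 0"
    using g by (rule lipschitz_on_nonneg)
  have [measurable]: "g \<in> borel_measurable borel"
    using lipschitz_on_continuous_on[OF g] by (rule borel_measurable_continuous_onI)
  define q where "q = (\<lambda>n x. (g (x + 1 / real (Suc n)) - g x) / (1 / real (Suc n)))"
  define D where "D = (\<lambda>x. max (- L) (min L (lim (\<lambda>n. q n x))))"
  have [measurable]: "q n \<in> borel_measurable borel" for n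
    unfolding q_def by measurable
  have "(\<lambda>x. lim (\<lambda>n. q n x)) \<in> borel_measurable borel"
    by (rule borel_measurable_lim_metric) measurable
  then show "D \<in> borel_measurable borel"
    unfolding D_def by measurable
  show "\<bar>D x\<bar> \<le> L" for x
    using \<open>L \<ge> 0\<close> by (auto simp: D_def)
  have "(g has_real_derivative D x) (at x)" if diff: "g field_differentiable (at x)" for x
  proof -
    obtain D' where D': "(g has_real_derivative D') (at x)"
      using diff by (auto simp: field_differentiable_def)
    have "(\<lambda>n. 1 / real (Suc n)) \<longlonglongrightarrow> 0"
      by (rule LIMSEQ_Suc) (rule lim_1_over_n)
    then have "filterlim (\<lambda>n. 1 / real (Suc n)) (at 0) sequentially"
      by (auto simp: filterlim_at)
    then have lim: "(\<lambda>n. q n x) \<longlonglongrightarrow> D'"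
      unfolding q_def by (rule filterlim_compose[OF D'[unfolded DERIV_def]])
    have q_le: "\<bar>q n x\<bar> \<le> L" for n
    proof -
      have "\<bar>g (x + 1 / real (Suc n)) - g x\<bar> \<le> L * (1 / real (Suc n))"
        using lipschitz_onD[OF g, of "x + 1 / real (Suc n)" x] by (simp add: dist_real_def)
      then show ?thesis
        unfolding q_def abs_divide by (subst divide_le_eq) auto
    qed
    have "\<bar>D'\<bar> \<le> L"
      using tendsto_rabs[OF lim] by (rule LIMSEQ_le_const2) (use q_le in auto)
    moreover have "lim (\<lambda>n. q n x) = D'"
      using lim by (rule limI)
    ultimately have "D x = D'"
      by (auto simp: D_def)
    with D' show ?thesis
      by simp
  qed
  then show "negligible {x. \<not> (g has_real_derivative D x) (at x)}"
    by (intro negligible_subset[OF negligible_nondifferentiable_lipschitz[OF g]]) blast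
qed

text \<open>Each isolated point is the only point of \<open>S\<close> in some member of a countable basis.\<close>

lemma countable_isolated_points:
  fixes S :: "'a::second_countable_topology set"
  shows "countable {x \<in> S. \<not> x islimpt S}"
proof -
  obtain B :: "'a set set" where B: "countable B" "topological_basis B"
    using ex_countable_basis by blast
  have "{x \<in> S. \<not> x islimpt S} \<subseteq> (\<lambda>b. the_elem (S \<inter> b)) ` B"
  proof
    fix x assume x: "x \<in> {x \<in> S. \<not> x islimpt S}"
    then obtain T where T: "open T" "x \<in> T" "\<And>y. y \<in> S \<Longrightarrow> y \<in> T \<Longrightarrow> y = x"
      by (auto simp: islimpt_def)
    obtain b where "b \<in> B" "x \<in> b" "b \<subseteq> T"
      using topological_basisE[OF B(2) T(1,2)] .
    moreover have "S \<inter> b = {x}"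
      using T(3) x calculation by auto
    ultimately show "x \<in> (\<lambda>b. the_elem (S \<inter> b)) ` B"
      by (intro image_eqI[of _ _ b]) auto
  qed
  then show ?thesis
    using B(1) by (meson countable_image countable_subset)
qed

section \<open>Change of variables with signs\<close>

text \<open>The area formula for an injective, not necessarily monotone, \<open>g\<close> has the factor \<open>\<bar>D\<bar>\<close>, where \<open>D\<close> is
  the derivative of \<open>g\<close>.  With the factor \<open>D\<close> instead, the sign of \<open>D\<close> goes into the transported
  function \<open>\<sigma>(g t) = u(t) sgn (D t)\<close>.  Since \<open>g\<close> expands distances at least by \<open>1/C\<close>, \<open>D\<close> cannot
  vanish at a non-isolated point of \<open>Q\<close>; this is why \<open>\<bar>\<sigma>\<bar>\<close> agrees with the transported \<open>\<bar>u\<bar>\<close> almost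
  everywhere.\<close>

lemma signed_change_of_variables:
  fixes g D u :: "real \<Rightarrow> real"
  assumes g: "L-lipschitz_on UNIV g"
    and D [measurable]: "D \<in> borel_measurable borel" and D_le: "\<And>x. \<bar>D x\<bar> \<le> L"
    and D_deriv: "negligible {x. \<not> (g has_real_derivative D x) (at x)}"
    and Q: "Q \<in> sets lebesgue" and "C > 0"
    and expand: "\<And>s t. s \<in> Q \<Longrightarrow> t \<in> Q \<Longrightarrow> \<bar>s - t\<bar> \<le> C * \<bar>g s - g t\<bar>"
    and u: "u absolutely_integrable_on Q"
  obtains \<sigma> where "\<And>x. x \<notin> g ` Q \<Longrightarrow> \<sigma> x = 0"
    "negligible {x. \<exists>t\<in>Q. g t = x \<and> \<bar>\<sigma> x\<bar> \<noteq> \<bar>u t\<bar>}"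
    "\<And>B. B \<in> sets borel \<Longrightarrow> (\<lambda>t. indicator B (g t) * (u t * D t)) absolutely_integrable_on Q"
    "\<And>B. B \<in> sets borel \<Longrightarrow> \<sigma> absolutely_integrable_on B"
    "\<And>B. B \<in> sets borel \<Longrightarrow> integral B \<sigma> = integral Q (\<lambda>t. indicator B (g t) * (u t * D t))"
proof -
  have [measurable]: "g \<in> borel_measurable borel"
    using lipschitz_on_continuous_on[OF g] by (rule borel_measurable_continuous_onI)
  have g_lip: "\<bar>g s - g t\<bar> \<le> L * \<bar>s - t\<bar>" for s t
    using lipschitz_onD[OF g, of s t] by (simp add: dist_real_def)
  define Z where "Z = {x. \<not> (g has_real_derivative D x) (at x)} \<union> {x \<in> Q. \<not> x islimpt Q}"
  define S where "S = Q - Z"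
  have Z: "negligible Z"
    unfolding Z_def using D_deriv countable_isolated_points[of Q]
    by (intro negligible_Un) (simp_all add: negligible_iff_null_sets null_sets_completionI
          countable_imp_null_set_lborel)
  have S: "S \<in> sets lebesgue" "S \<subseteq> Q"
    using Q negligible_imp_sets[OF Z] by (auto simp: S_def)
  have negl_diff: "negligible {x \<in> Q - S. f x \<noteq> 0}" "negligible {x \<in> S - Q. f x \<noteq> 0}" for f :: "real \<Rightarrow> real"
    using Z by (auto simp: S_def intro: negligible_subset)
  have inj: "inj_on g S"
    using expand S(2) by (intro inj_onI) fastforce
  have deriv: "(g has_real_derivative D t) (at t)" if "t \<in> S" for t
    using that by (simp add: S_def Z_def)
  have D_nz: "D t \<noteq> 0" if "t \<in> S" for t
  proof
    assume "D t = 0"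
    with deriv[OF that] have "((\<lambda>y. (g y - g t) / (y - t)) \<longlongrightarrow> 0) (at t)"
      by (simp add: has_field_derivative_iff)
    then obtain d where d: "d > 0"
      "\<And>y. 0 < dist y t \<Longrightarrow> dist y t < d \<Longrightarrow> dist ((g y - g t) / (y - t)) 0 < 1 / C"
      using \<open>C > 0\<close> unfolding Lim_at by (metis zero_less_divide_1_iff)
    have "t islimpt Q" "t \<in> Q"
      using that by (auto simp: S_def Z_def)
    then obtain y where y: "y \<in> Q" "y \<noteq> t" "dist y t < d"
      using d(1) unfolding islimpt_approachable by blast
    have "\<bar>g y - g t\<bar> / \<bar>y - t\<bar> < 1 / C"
      using d(2)[of y] y by (simp add: abs_divide)
    then have "C * \<bar>g y - g t\<bar> < \<bar>y - t\<bar>"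
      using \<open>C > 0\<close> y(2) by (simp add: field_simps)
    with expand[OF y(1) \<open>t \<in> Q\<close>] show False
      by simp
  qed
  define \<sigma> where "\<sigma> = (\<lambda>x. if x \<in> g ` S then u (inv_into S g x) * sgn (D (inv_into S g x)) else 0)"
  have \<sigma>_g: "\<sigma> (g t) = u t * sgn (D t)" if "t \<in> S" for t
    using that inj by (simp add: \<sigma>_def)
  have bad: "negligible {x. \<exists>t\<in>Q. g t = x \<and> \<bar>\<sigma> x\<bar> \<noteq> \<bar>u t\<bar>}"
  proof (rule negligible_subset)
    show "negligible (g ` Z)"
      using Z g_lip by (intro negligible_locally_Lipschitz_image) (auto intro!: exI[of _ UNIV] exI[of _ L])
    show "{x. \<exists>t\<in>Q. g t = x \<and> \<bar>\<sigma> x\<bar> \<noteq> \<bar>u t\<bar>} \<subseteq> g ` Z"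
    proof safe
      fix t assume t: "t \<in> Q" "\<bar>\<sigma> (g t)\<bar> \<noteq> \<bar>u t\<bar>"
      have "t \<notin> S"
        using t(2) \<sigma>_g[of t] D_nz[of t] by (auto simp: abs_mult abs_sgn_eq)
      with t(1) show "g t \<in> g ` Z"
        by (auto simp: S_def)
    qed
  qed
  have uS: "u absolutely_integrable_on S"
    using u by (rule absolutely_integrable_spike_set) (rule negl_diff)+
  have key: "(\<lambda>t. indicator B (g t) * (u t * D t)) absolutely_integrable_on S"
      "(\<lambda>x. indicator B x * \<sigma> x) absolutely_integrable_on (g ` S)"
      "integral (g ` S) (\<lambda>x. indicator B x * \<sigma> x) = integral S (\<lambda>t. indicator B (g t) * (u t * D t))"
    if B [measurable]: "B \<in> sets borel" for B
  proof -
    have "(\<lambda>t. (indicator B (g t) * D t) * u t) absolutely_integrable_on S"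
    proof (rule absolutely_integrable_bounded_measurable_product_real[OF _ S(1) _ uS])
      have "(\<lambda>t. indicator B (g t) * D t) \<in> borel_measurable lborel"
        by measurable
      then have "(\<lambda>t. indicator B (g t) * D t) \<in> borel_measurable lebesgue"
        by (rule measurable_completion)
      then show "(\<lambda>t. indicator B (g t) * D t) \<in> borel_measurable (lebesgue_on S)"
        by (rule measurable_restrict_space1)
      show "bounded ((\<lambda>t. indicator B (g t) * D t) ` S)"
        using D_le order_trans[OF abs_ge_zero D_le]
        by (intro boundedI[of _ L]) (auto simp: indicator_def)
    qed
    then show 1: "(\<lambda>t. indicator B (g t) * (u t * D t)) absolutely_integrable_on S"
      by (simp add: ac_simps)
    have eqS: "\<bar>D t\<bar> * (indicator B (g t) * \<sigma> (g t)) = indicator B (g t) * (u t * D t)" if "t \<in> S" for t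
      using \<sigma>_g[OF that] by (simp add: sgn_if abs_if)
    then have "(\<lambda>t. \<bar>D t\<bar> * (indicator B (g t) * \<sigma> (g t))) absolutely_integrable_on S \<and>
        integral S (\<lambda>t. \<bar>D t\<bar> * (indicator B (g t) * \<sigma> (g t))) = integral S (\<lambda>t. indicator B (g t) * (u t * D t))"
      by (intro conjI set_integrable_cong[THEN iffD2, OF refl refl eqS 1] integral_cong[OF eqS])
    then show "(\<lambda>x. indicator B x * \<sigma> x) absolutely_integrable_on (g ` S)"
      "integral (g ` S) (\<lambda>x. indicator B x * \<sigma> x) = integral S (\<lambda>t. indicator B (g t) * (u t * D t))"
      using has_absolute_integral_change_of_variables_1'[OF S(1) _ inj,
          of D "\<lambda>x. indicator B x * \<sigma> x"
            "integral S (\<lambda>t. indicator B (g t) * (u t * D t))"] deriv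
      by (auto intro: has_field_derivative_at_within)
  qed
  show ?thesis
  proof
    show "\<sigma> x = 0" if "x \<notin> g ` Q" for x
      using that S(2) by (auto simp: \<sigma>_def)
    show "negligible {x. \<exists>t\<in>Q. g t = x \<and> \<bar>\<sigma> x\<bar> \<noteq> \<bar>u t\<bar>}"
      by (rule bad)
    fix B :: "real set" assume B: "B \<in> sets borel"
    show "(\<lambda>t. indicator B (g t) * (u t * D t)) absolutely_integrable_on Q"
      using key(1)[OF B] by (rule absolutely_integrable_spike_set) (rule negl_diff)+
    have eq: "(\<lambda>x. if x \<in> g ` S then indicator B x * \<sigma> x else 0) = (\<lambda>x. if x \<in> B then \<sigma> x else 0)"
      by (auto simp: \<sigma>_def indicator_def fun_eq_iff)
    show "\<sigma> absolutely_integrable_on B"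
      using key(2)[OF B] unfolding absolutely_integrable_restrict_UNIV[of B, symmetric]
        absolutely_integrable_restrict_UNIV[of "g ` S", symmetric] eq .
    have "integral B \<sigma> = integral UNIV (\<lambda>x. if x \<in> B then \<sigma> x else 0)"
      by (rule integral_restrict_UNIV[symmetric])
    also have "\<dots> = integral (g ` S) (\<lambda>x. indicator B x * \<sigma> x)"
      unfolding eq[symmetric] by (rule integral_restrict_UNIV)
    also have "\<dots> = integral Q (\<lambda>t. indicator B (g t) * (u t * D t))"
      unfolding key(3)[OF B] by (rule integral_spike_set) (rule negl_diff)+
    finally show "integral B \<sigma> = integral Q (\<lambda>t. indicator B (g t) * (u t * D t))" .
  qed
qed

section \<open>Null sets of the one-dimensional Hausdorff measure\<close>

text \<open>A cover of the image pulls back to a cover of \<open>A\<close> by sets of no larger diameter, and a set of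
  diameter \<open>\<delta>\<close> on the line lies in an interval of length \<open>2\<delta>\<close> around any of its points.\<close>

lemma negligible_hausdorff1_null:
  fixes \<gamma> :: "real \<Rightarrow> 'a::metric_space"
  assumes \<gamma>: "\<And>s t. s \<in> A \<Longrightarrow> t \<in> A \<Longrightarrow> \<bar>s - t\<bar> \<le> dist (\<gamma> s) (\<gamma> t)"
    and null: "hausdorff1 (\<gamma> ` A) = 0"
  shows "negligible A"
  unfolding negligible_outer_le
proof (intro allI impI)
  fix e :: real assume "e > 0"
  have "hausdorff1_premeasure 1 (\<gamma> ` A) \<le> hausdorff1 (\<gamma> ` A)"
    unfolding hausdorff1_def by (rule SUP_upper) simp
  also have "\<dots> < ennreal (e / 2)"
    using null \<open>e > 0\<close> by simp
  finally obtain C :: "nat \<Rightarrow> 'a set" where cover: "\<gamma> ` A \<subseteq> (\<Union>i. C i)"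
    and bdd: "\<And>i. bounded (C i)" and small: "(\<Sum>i. ennreal (diameter (C i))) < ennreal (e / 2)"
    unfolding hausdorff1_premeasure_def Inf_less_iff by auto
  \<comment> \<open>if no point of \<open>A\<close> is mapped into \<open>C i\<close>, then \<open>c i\<close> is arbitrary and its interval harmless\<close>
  define c where "c = (\<lambda>i. SOME s. s \<in> A \<and> \<gamma> s \<in> C i)"
  define T where "T = (\<Union>i. cball (c i) (diameter (C i)))"
  have diam: "diameter (C i) \<ge> 0" for i
    using bdd by (rule diameter_ge_0)
  have "A \<subseteq> T"
  proof
    fix t assume t: "t \<in> A"
    then obtain i where i: "\<gamma> t \<in> C i"
      using cover by auto
    have c: "c i \<in> A \<and> \<gamma> (c i) \<in> C i"
      unfolding c_def by (rule someI[of _ t]) (use t i in simp)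
    have "dist (c i) t \<le> dist (\<gamma> (c i)) (\<gamma> t)"
      using \<gamma>[of "c i" t] c t by (simp add: dist_real_def)
    also have "\<dots> \<le> diameter (C i)"
      using bdd c i by (intro diameter_bounded_bound) auto
    finally show "t \<in> T"
      by (auto simp: T_def)
  qed
  moreover have T_borel: "T \<in> sets borel"
    by (auto simp: T_def)
  have "emeasure lborel T \<le> ennreal e"
  proof -
    have "emeasure lborel T \<le> (\<Sum>i. emeasure lborel (cball (c i) (diameter (C i))))"
      unfolding T_def by (rule emeasure_subadditive_countably) auto
    also have "\<dots> = (\<Sum>i. 2 * ennreal (diameter (C i)))"
      using diam by (intro suminf_cong) (simp add: cball_eq_atLeastAtMost ennreal_mult'[symmetric]
         flip: ennreal_numeral)
    also have "\<dots> = 2 * (\<Sum>i. ennreal (diameter (C i)))"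
      by (rule ennreal_suminf_cmult)
    also have "\<dots> \<le> 2 * ennreal (e / 2)"
      using small by (intro mult_left_mono) auto
    also have "\<dots> = ennreal e"
      using \<open>e > 0\<close> by (simp add: ennreal_mult'[symmetric] flip: ennreal_numeral)
    finally show ?thesis .
  qed
  then have "emeasure lebesgue T \<le> ennreal e"
    using T_borel by simp
  then have "T \<in> lmeasurable \<and> measure lebesgue T \<le> e"
    using T_borel \<open>e > 0\<close> by (auto simp: fmeasurable_def measure_def enn2real_leI less_top[symmetric] top_unique le_less_trans)
  ultimately show "\<exists>T. A \<subseteq> T \<and> T \<in> lmeasurable \<and> measure lebesgue T \<le> e"
    by blast
qed

section \<open>Averages over intervals and sums of charts\<close>

text \<open>By Lebesgue's differentiation theorem, almost every value of \<open>f\<close> is a limit of averages.  That theorem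
  is about Borel functions, so \<open>f\<close> is replaced by a Borel function \<open>f'\<close> equal to it almost everywhere.\<close>

lemma negligible_interval_averages_neq:
  fixes f :: "real \<Rightarrow> real"
  assumes f: "f absolutely_integrable_on {a..b}"
    and avg: "\<And>s h. a \<le> s \<Longrightarrow> 0 < h \<Longrightarrow> s + h \<le> b \<Longrightarrow> integral {s..s + h} f = c * h"
  shows "negligible {x \<in> {a<..<b}. f x \<noteq> c}"
proof -
  define F where "F = (\<lambda>x. indicator {a..b} x * f x)"
  have F: "integrable lebesgue F"
    using f by (simp add: F_def set_integrable_def)
  obtain f' where f' [measurable]: "f' \<in> borel_measurable lborel" and eq: "AE x in lborel. F x = f' x"
    using completion_ex_borel_measurable_real[OF borel_measurable_integrable[OF F]] by blast
  have eq': "AE x in lebesgue. F x = f' x"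
    using eq by (rule AE_completion)
  have "integrable lebesgue f'"
    by (rule iffD1[OF integrable_cong_AE[OF borel_measurable_integrable[OF F] measurable_completion[OF f'] eq'] F])
  then have "integrable lborel f'"
    by (simp add: integrable_completion)
  define leb where "leb x \<longleftrightarrow> (\<forall>\<epsilon>>0. \<exists>\<delta>>0. \<forall>a b. a \<le> b \<longrightarrow> x \<in> {a..b} \<longrightarrow> b - a < \<delta> \<longrightarrow>
      \<bar>(LINT y:{a..b}|lborel. f' y) - f' x * (b - a)\<bar> \<le> \<epsilon> * (b - a))" for x
  have leb: "negligible {x. \<not> leb x}"
    unfolding leb_def using \<open>integrable lborel f'\<close> by (rule lebesgue_differentiation_real)
  have int: "(LINT y:{s..s + h}|lborel. f' y) = c * h" if "a \<le> s" "0 < h" "s + h \<le> b" for s h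
  proof -
    have "(LINT y:{s..s + h}|lborel. f' y) = (LINT y:{s..s + h}|lebesgue. f' y)"
      unfolding set_lebesgue_integral_def by (rule integral_completion[symmetric]) measurable
    also have "\<dots> = (LINT y:{s..s + h}|lebesgue. f y)"
      unfolding set_lebesgue_integral_def
    proof (rule integral_cong_AE)
      show "(\<lambda>x. indicator {s..s + h} x *\<^sub>R f' x) \<in> borel_measurable lebesgue"
        by (rule measurable_completion) measurable
      have "f absolutely_integrable_on {s..s + h}"
        using f that by (elim set_integrable_subset) auto
      then show "(\<lambda>x. indicator {s..s + h} x *\<^sub>R f x) \<in> borel_measurable lebesgue"
        unfolding set_integrable_def by (rule borel_measurable_integrable)
      show "AE x in lebesgue. indicator {s..s + h} x *\<^sub>R f' x = indicator {s..s + h} x *\<^sub>R f x"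
        using eq' by eventually_elim (use that in \<open>auto simp: F_def indicator_def split: if_splits\<close>)
    qed
    also have "\<dots> = integral {s..s + h} f"
      using f that by (intro set_lebesgue_integral_eq_integral) (auto elim!: set_integrable_subset)
    finally show ?thesis
      using avg that by simp
  qed
  have "negligible {x. F x \<noteq> f' x}"
    using eq' by (auto simp: eventually_ae_filter negligible_iff_null_sets
        elim!: null_sets_completion_subset)
  with leb have negl: "negligible ({x. \<not> leb x} \<union> {x. F x \<noteq> f' x})"
    by (rule negligible_Un)
  have lebesgue_point: "f' x = c" if x: "x \<in> {a<..<b}" and lx: "leb x" for x
  proof (rule ccontr)
    assume "f' x \<noteq> c"
    then have "\<bar>c - f' x\<bar> / 2 > 0" by simp
    then obtain \<delta> where "\<delta> > 0" and \<delta>: "\<And>a b. a \<le> b \<Longrightarrow> x \<in> {a..b} \<Longrightarrow> b - a < \<delta> \<Longrightarrow>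
           \<bar>(LINT y:{a..b}|lborel. f' y) - f' x * (b - a)\<bar> \<le> (\<bar>c - f' x\<bar> / 2) * (b - a)"
      using lx unfolding leb_def by blast
    define h where "h = min (\<delta> / 2) (b - x)"
    have h: "h > 0" "h < \<delta>" "x + h \<le> b"
      using \<open>\<delta> > 0\<close> x by (auto simp: h_def)
    have "\<bar>c * h - f' x * h\<bar> \<le> (\<bar>c - f' x\<bar> / 2) * h"
      using \<delta>[of x "x + h"] int[of x h] h x by simp
    moreover have "\<bar>c * h - f' x * h\<bar> = \<bar>c - f' x\<bar> * h"
      using h by (simp add: abs_mult left_diff_distrib[symmetric])
    ultimately show False
      using h \<open>f' x \<noteq> c\<close> by simp
  qed
  from negl show ?thesis
  proof (rule negligible_subset)
    show "{x \<in> {a<..<b}. f x \<noteq> c} \<subseteq> {x. \<not> leb x} \<union> {x. F x \<noteq> f' x}"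
    proof
      fix x assume x: "x \<in> {x \<in> {a<..<b}. f x \<noteq> c}"
      then have "F x = f x"
        by (simp add: F_def)
      with x lebesgue_point[of x] show "x \<in> {x. \<not> leb x} \<union> {x. F x \<noteq> f' x}"
        by auto
    qed
  qed
qed

text \<open>At almost every point a single term is nonzero, and it is a sign, so the partial sums are dominated
  by the indicator of the interval.\<close>

lemma sums_integral_disjoint_unit:
  fixes \<tau> :: "nat \<Rightarrow> real \<Rightarrow> real"
  assumes \<tau>: "\<And>i. integrable lebesgue (\<tau> i)"
    and unit: "negligible {x \<in> {a..b}. \<not> (\<exists>i. \<bar>\<tau> i x\<bar> = 1 \<and> (\<forall>k. k \<noteq> i \<longrightarrow> \<tau> k x = 0))}" (is "negligible ?N")
  shows "(\<lambda>x. \<Sum>i. \<tau> i x) absolutely_integrable_on {a..b}"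
    and "(\<lambda>i. integral {a..b} (\<tau> i)) sums integral {a..b} (\<lambda>x. \<Sum>i. \<tau> i x)"
proof -
  let ?I = "{a..b}" and ?w = "\<lambda>x. \<Sum>i. \<tau> i x"
  define f where "f = (\<lambda>k x. indicator ?I x *\<^sub>R (\<Sum>i<k. \<tau> i x))"
  have meas: "\<tau> i \<in> borel_measurable lebesgue" for i
    using \<tau> by (rule borel_measurable_integrable)
  have wm: "(\<lambda>x. indicator ?I x *\<^sub>R ?w x) \<in> borel_measurable lebesgue"
    by (intro borel_measurable_scaleR borel_measurable_indicator borel_measurable_suminf meas) auto
  have fm: "f k \<in> borel_measurable lebesgue" for k
    unfolding f_def
    by (intro borel_measurable_scaleR borel_measurable_indicator borel_measurable_sum meas) auto
  have good: "AE x in lebesgue. x \<notin> ?N"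
    using unit by (intro AE_not_in) (simp add: negligible_iff_null_sets)
  have sums_at: "(\<lambda>i. \<tau> i x) sums \<tau> j x \<and> \<bar>\<Sum>i<k. \<tau> i x\<bar> \<le> 1"
    if "\<bar>\<tau> j x\<bar> = 1" "\<forall>k. k \<noteq> j \<longrightarrow> \<tau> k x = 0" for x j k
  proof -
    have *: "(\<lambda>i. \<tau> i x) = (\<lambda>i. if i = j then \<tau> j x else 0)"
      using that by (simp add: fun_eq_iff)
    have "\<bar>\<Sum>i<k. if i = j then \<tau> j x else 0\<bar> \<le> 1"
      using that(1) by (simp add: sum.delta)
    then show ?thesis
      unfolding * using sums_single[of j "\<lambda>_. \<tau> j x"] by blast
  qed
  have lim: "AE x in lebesgue. (\<lambda>k. f k x) \<longlonglongrightarrow> indicator ?I x *\<^sub>R ?w x"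
    using good
  proof eventually_elim
    case (elim x)
    show ?case
    proof (cases "x \<in> ?I")
      case True
      then obtain j where "\<bar>\<tau> j x\<bar> = 1" "\<forall>k. k \<noteq> j \<longrightarrow> \<tau> k x = 0"
        using elim by blast
      then have "(\<lambda>i. \<tau> i x) sums ?w x"
        using sums_at by (meson summable_sums sums_summable)
      then show ?thesis
        using True by (simp add: f_def sums_def)
    qed (simp add: f_def)
  qed
  have bound: "AE x in lebesgue. norm (f k x) \<le> indicator ?I x" for k
    using good
  proof eventually_elim
    case (elim x)
    show ?case
    proof (cases "x \<in> ?I")
      case True
      then obtain j where "\<bar>\<tau> j x\<bar> = 1" "\<forall>k. k \<noteq> j \<longrightarrow> \<tau> k x = 0"
        using elim by blast
      then show ?thesis
        using True sums_at[of j x k] by (simp add: f_def)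
    qed (simp add: f_def)
  qed
  have ind: "integrable lebesgue (indicator ?I :: real \<Rightarrow> real)"
    by (intro integrable_real_indicator) (auto simp: emeasure_lborel_Icc_eq)
  show w: "?w absolutely_integrable_on ?I"
    unfolding set_integrable_def by (rule integrable_dominated_convergence[OF wm fm ind lim bound])
  have "(\<lambda>k. integral\<^sup>L lebesgue (f k)) \<longlonglongrightarrow> (LINT x|lebesgue. indicator ?I x *\<^sub>R ?w x)"
    by (rule integral_dominated_convergence[OF wm fm ind lim bound])
  moreover have \<tau>I: "\<tau> i absolutely_integrable_on ?I" for i
    unfolding set_integrable_def using \<tau> by (intro integrable_mult_indicator) auto
  have "integral\<^sup>L lebesgue (f k) = (\<Sum>i<k. integral ?I (\<tau> i))" for k
  proof -
    have "integral\<^sup>L lebesgue (f k) = (\<Sum>i<k. LINT x|lebesgue. indicator ?I x *\<^sub>R \<tau> i x)"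
      unfolding f_def scaleR_sum_right using \<tau>I
      by (intro Bochner_Integration.integral_sum) (simp add: set_integrable_def)
    also have "\<dots> = (\<Sum>i<k. integral ?I (\<tau> i))"
      using set_lebesgue_integral_eq_integral(2)[OF \<tau>I] by (simp add: set_lebesgue_integral_def)
    finally show ?thesis .
  qed
  moreover have "(LINT x|lebesgue. indicator ?I x *\<^sub>R ?w x) = integral ?I ?w"
    using set_lebesgue_integral_eq_integral(2)[OF w] by (simp add: set_lebesgue_integral_def)
  ultimately show "(\<lambda>i. integral ?I (\<tau> i)) sums integral ?I ?w"
    by (simp add: sums_def)
qed

section \<open>Ramp functions\<close>

text \<open>The cut-off profile.  Its derivative is \<open>-1/h\<close> on the transition interval \<open>[s, s + h]\<close> and 0 elsewhere, so
  testing a boundary with it takes averages over that interval.\<close>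

definition ramp :: "real \<Rightarrow> real \<Rightarrow> real \<Rightarrow> real" where
  "ramp s h x = max 0 (min 1 ((s + h - x) / h))"

lemma ramp_bounds: "0 \<le> ramp s h x" "ramp s h x \<le> 1"
  by (simp_all add: ramp_def)

lemma ramp_inner: "0 < h \<Longrightarrow> x \<le> s \<Longrightarrow> ramp s h x = 1"
  by (simp add: ramp_def min_def max_def field_simps)

lemma ramp_outer: "0 < h \<Longrightarrow> s + h \<le> x \<Longrightarrow> ramp s h x = 0"
  by (simp add: ramp_def min_def max_def field_simps)

lemma ramp_lipschitz: "0 < h \<Longrightarrow> \<bar>ramp s h x - ramp s h y\<bar> \<le> (1 / h) * \<bar>x - y\<bar>"
proof -
  assume "0 < h"
  have "\<bar>ramp s h x - ramp s h y\<bar> \<le> \<bar>(s + h - x) / h - (s + h - y) / h\<bar>"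
    unfolding ramp_def by linarith
  also have "\<dots> = (1 / h) * \<bar>x - y\<bar>"
    using \<open>0 < h\<close> by (simp add: diff_divide_distrib[symmetric] abs_divide abs_minus_commute)
  finally show ?thesis .
qed

lemma ramp_deriv:
  assumes "0 < h" "x \<noteq> s" "x \<noteq> s + h"
  shows "(ramp s h has_real_derivative (if x \<in> {s..s + h} then - (1 / h) else 0)) (at x)"
proof -
  consider "x < s" | "s < x" "x < s + h" | "s + h < x"
    using assms by linarith
  then show ?thesis
  proof cases
    case 1
    have "(ramp s h has_real_derivative 0) (at x)"
      by (rule has_field_derivative_transform_within_open[of "\<lambda>_. 1" _ _ "{..<s}"])
        (use 1 assms in \<open>auto simp: ramp_inner\<close>)
    then show ?thesis using 1 by simp
  next
    case 2
    have "((\<lambda>x. (s + h - x) / h) has_real_derivative - (1 / h)) (at x)"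
      using \<open>0 < h\<close> by (auto intro!: derivative_eq_intros)
    then have "(ramp s h has_real_derivative - (1 / h)) (at x)"
      by (rule has_field_derivative_transform_within_open[of _ _ _ "{s<..<s + h}"])
        (use 2 assms in \<open>auto simp: ramp_def min_def max_def field_simps\<close>)
    then show ?thesis using 2 by simp
  next
    case 3
    have "(ramp s h has_real_derivative 0) (at x)"
      by (rule has_field_derivative_transform_within_open[of "\<lambda>_. 0" _ _ "{s + h<..}"])
        (use 3 assms in \<open>auto simp: ramp_outer\<close>)
    then show ?thesis using 3 by simp
  qed
qed

section \<open>One-dimensional currents in a star\<close>

text \<open>A star around \<open>v\<close> whose radius \<open>r\<close> is measured in the ambient metric: every point at distance
  less than \<open>r\<close> from \<open>v\<close> lies on an arm.  With isometric arms, a point of the star is then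
  determined by its arm and its distance to \<open>v\<close>.\<close>

locale star_arms =
  fixes v :: "'a::metric_space" and d :: nat and r :: real and \<gamma> :: "nat \<Rightarrow> real \<Rightarrow> 'a"
  assumes arm_isometric: "\<And>j s t. j < d \<Longrightarrow> s \<in> {0..r} \<Longrightarrow> t \<in> {0..r} \<Longrightarrow> dist (\<gamma> j s) (\<gamma> j t) = \<bar>s - t\<bar>"
    and arm_center: "\<And>j. j < d \<Longrightarrow> \<gamma> j 0 = v"
    and arm_cover: "\<And>y. 0 < dist y v \<Longrightarrow> dist y v < r \<Longrightarrow> \<exists>j<d. y \<in> \<gamma> j ` {0..r}"
    and arm_disjoint: "\<And>i j. i < d \<Longrightarrow> j < d \<Longrightarrow> i \<noteq> j \<Longrightarrow> \<gamma> i ` {0..r} \<inter> \<gamma> j ` {0..r} = {v}"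
begin

lemma dist_arm: "j < d \<Longrightarrow> s \<in> {0..r} \<Longrightarrow> dist (\<gamma> j s) v = s"
  using arm_isometric[of j s 0] arm_center[of j] by auto

lemma on_arm: "j < d \<Longrightarrow> y \<in> \<gamma> j ` {0..r} \<Longrightarrow> y = \<gamma> j (dist y v)"
  using dist_arm by auto

lemma arm_unique:
  assumes "i < d" "j < d" "y \<in> \<gamma> i ` {0..r}" "y \<in> \<gamma> j ` {0..r}" "y \<noteq> v"
  shows "i = j"
  using arm_disjoint[of i j] assms by blast

text \<open>The contribution of one chart.  Composed with \<open>\<phi>\<close>, the distance to \<open>v\<close> is a Lipschitz function on
  \<open>K\<close>; \<open>g\<close> extends it to the line.  On the part \<open>Q j\<close> of \<open>K\<close> that is mapped to the arm \<open>j\<close>, \<open>\<phi>\<close> is \<open>\<gamma> j\<close>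
  after \<open>g\<close>, so \<open>g\<close> is bi-Lipschitz there because \<open>\<phi>\<close> is and the arm is isometric.  So
  \<open>signed_change_of_variables\<close> applies on each \<open>Q j\<close>, and \<open>\<sigma> j\<close> is the signed coefficient of the chart on
  the arm \<open>j\<close>, as a function of the distance to \<open>v\<close>.\<close>

lemma chart_current_ramp:
  fixes \<phi> :: "real \<Rightarrow> 'a" and u :: "real \<Rightarrow> int"
  assumes K: "compact K" and bi: "bi_lipschitz_on K \<phi>"
    and u: "integrable lebesgue (\<lambda>t. real_of_int (u t))"
  obtains \<sigma> :: "nat \<Rightarrow> real \<Rightarrow> real" where
    "\<And>j x. j < d \<Longrightarrow> \<gamma> j x \<notin> \<phi> ` K \<Longrightarrow> \<sigma> j x = 0"
    "\<And>j. j < d \<Longrightarrow> negligible {x \<in> {0<..<r}. \<exists>t\<in>K. \<phi> t = \<gamma> j x \<and> \<bar>\<sigma> j x\<bar> \<noteq> \<bar>real_of_int (u t)\<bar>}"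
    "\<And>j. j < d \<Longrightarrow> integrable lebesgue (\<sigma> j)"
    "\<And>s h. 0 < s \<Longrightarrow> 0 < h \<Longrightarrow> s + h < r \<Longrightarrow>
       chart_current K \<phi> u (\<lambda>_. 1) (\<lambda>y. ramp s h (dist y v))
         = - (1 / h) * (\<Sum>j<d. integral {s..s + h} (\<sigma> j))"
proof -
  obtain C where C: "C > 0"
    and bi_lower: "\<And>s t. s \<in> K \<Longrightarrow> t \<in> K \<Longrightarrow> dist s t / C \<le> dist (\<phi> s) (\<phi> t)"
    and bi_upper: "\<And>s t. s \<in> K \<Longrightarrow> t \<in> K \<Longrightarrow> dist (\<phi> s) (\<phi> t) \<le> C * dist s t"
    using bi unfolding bi_lipschitz_on_def by blast
  have "C-lipschitz_on K \<phi>"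
    using bi_upper C by (intro lipschitz_onI) auto
  then have cont_\<phi>: "continuous_on K \<phi>"
    by (rule lipschitz_on_continuous_on)
  have inj_\<phi>: "inj_on \<phi> K"
  proof (rule inj_onI)
    fix s t assume st: "s \<in> K" "t \<in> K" "\<phi> s = \<phi> t"
    then have "dist s t / C \<le> 0"
      using bi_lower[of s t] by simp
    then show "s = t"
      using C by (simp add: divide_le_0_iff)
  qed
  have "C-lipschitz_on K (\<lambda>t. dist (\<phi> t) v)"
  proof (rule lipschitz_onI)
    fix s t assume "s \<in> K" "t \<in> K"
    have "dist (dist (\<phi> s) v) (dist (\<phi> t) v) \<le> dist (\<phi> s) (\<phi> t)"
      unfolding dist_real_def by (metis abs_dist_diff_le dist_commute)
    also have "\<dots> \<le> C * dist s t"
      using bi_upper \<open>s \<in> K\<close> \<open>t \<in> K\<close> .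
    finally show "dist (dist (\<phi> s) v) (dist (\<phi> t) v) \<le> C * dist s t" .
  qed (use C in simp)
  then obtain g where g: "C-lipschitz_on UNIV g" and g_K: "\<And>t. t \<in> K \<Longrightarrow> g t = dist (\<phi> t) v"
    by (rule lipschitz_extension_real) blast
  obtain D where D [measurable]: "D \<in> borel_measurable borel" and D_le: "\<And>x. \<bar>D x\<bar> \<le> C"
    and D_deriv: "negligible {x. \<not> (g has_real_derivative D x) (at x)}"
    using lipschitz_borel_derivative[OF g] by blast
  have [measurable]: "g \<in> borel_measurable borel"
    using lipschitz_on_continuous_on[OF g] by (rule borel_measurable_continuous_onI)
  define Q where "Q = (\<lambda>j. {t \<in> K. 0 < g t \<and> g t < r \<and> \<phi> t \<in> \<gamma> j ` {0..r}})"
  have Q_K: "Q j \<subseteq> K" for j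
    by (auto simp: Q_def)
  have Q_meas: "Q j \<in> sets lebesgue" if "j < d" for j
  proof -
    have "1-lipschitz_on {0..r} (\<gamma> j)"
      using arm_isometric[OF that] by (intro lipschitz_onI) (auto simp: dist_real_def)
    then have "compact (\<gamma> j ` {0..r})"
      by (intro compact_continuous_image lipschitz_on_continuous_on) auto
    then have "closed (K \<inter> \<phi> -` (\<gamma> j ` {0..r}))"
      using K cont_\<phi> by (intro continuous_closed_preimage compact_imp_closed)
    then have [measurable]: "K \<inter> \<phi> -` (\<gamma> j ` {0..r}) \<in> sets borel"
      by (rule borel_closed)
    have "{t. 0 < g t \<and> g t < r} \<in> sets borel"
      by measurable
    then have "(K \<inter> \<phi> -` (\<gamma> j ` {0..r})) \<inter> {t. 0 < g t \<and> g t < r} \<in> sets borel"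
      by measurable
    also have "(K \<inter> \<phi> -` (\<gamma> j ` {0..r})) \<inter> {t. 0 < g t \<and> g t < r} = Q j"
      by (auto simp: Q_def)
    finally show ?thesis
      by simp
  qed
  have Q_arm: "\<phi> t = \<gamma> j (g t)" if "j < d" "t \<in> Q j" for j t
    using on_arm[OF that(1), of "\<phi> t"] that(2) by (simp add: Q_def g_K)
  have u_Q: "(\<lambda>t. real_of_int (u t)) absolutely_integrable_on Q j" if "j < d" for j
    unfolding set_integrable_def using u Q_meas[OF that] by (intro integrable_mult_indicator)
  have expand: "\<bar>s - t\<bar> \<le> C * \<bar>g s - g t\<bar>" if "j < d" "s \<in> Q j" "t \<in> Q j" for j s t
  proof -
    have "dist (\<phi> s) (\<phi> t) = \<bar>g s - g t\<bar>"
      using that Q_arm[OF that(1,2)] Q_arm[OF that(1,3)] arm_isometric[OF that(1), of "g s" "g t"]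
      by (simp add: Q_def)
    with bi_lower[of s t] that Q_K C show ?thesis
      by (auto simp: dist_real_def divide_le_eq mult.commute)
  qed
  define P where "P j \<tau> \<longleftrightarrow> (\<forall>x. x \<notin> g ` Q j \<longrightarrow> \<tau> x = 0) \<and>
      negligible {x. \<exists>t\<in>Q j. g t = x \<and> \<bar>\<tau> x\<bar> \<noteq> \<bar>real_of_int (u t)\<bar>} \<and>
      (\<forall>B\<in>sets borel. (\<lambda>t. indicator B (g t) * (real_of_int (u t) * D t)) absolutely_integrable_on Q j \<and>
        \<tau> absolutely_integrable_on B \<and>
        integral B \<tau> = integral (Q j) (\<lambda>t. indicator B (g t) * (real_of_int (u t) * D t)))" for j \<tau>
  have "\<exists>\<tau>. P j \<tau>" if "j < d" for j
  proof (rule signed_change_of_variables[OF g D D_le D_deriv Q_meas[OF that] C expand[OF that] u_Q[OF that]])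
    fix \<tau>
    assume *: "\<And>x. x \<notin> g ` Q j \<Longrightarrow> \<tau> x = 0"
      "negligible {x. \<exists>t\<in>Q j. g t = x \<and> \<bar>\<tau> x\<bar> \<noteq> \<bar>real_of_int (u t)\<bar>}"
      "\<And>B. B \<in> sets borel \<Longrightarrow> (\<lambda>t. indicator B (g t) * (real_of_int (u t) * D t)) absolutely_integrable_on Q j"
      "\<And>B. B \<in> sets borel \<Longrightarrow> \<tau> absolutely_integrable_on B"
      "\<And>B. B \<in> sets borel \<Longrightarrow> integral B \<tau> = integral (Q j) (\<lambda>t. indicator B (g t) * (real_of_int (u t) * D t))"
    have "P j \<tau>"
      unfolding P_def by (intro conjI allI impI ballI *)
    then show "\<exists>\<tau>. P j \<tau>"
      by blast
  qed
  then obtain \<sigma> where \<sigma>: "\<And>j. j < d \<Longrightarrow> P j (\<sigma> j)"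
    by metis
  have \<sigma>_zero: "\<And>j x. j < d \<Longrightarrow> x \<notin> g ` Q j \<Longrightarrow> \<sigma> j x = 0"
    and \<sigma>_abs: "\<And>j. j < d \<Longrightarrow> negligible {x. \<exists>t\<in>Q j. g t = x \<and> \<bar>\<sigma> j x\<bar> \<noteq> \<bar>real_of_int (u t)\<bar>}"
    and uD_int: "\<And>j B. j < d \<Longrightarrow> B \<in> sets borel \<Longrightarrow>
      (\<lambda>t. indicator B (g t) * (real_of_int (u t) * D t)) absolutely_integrable_on Q j"
    and \<sigma>_int: "\<And>j B. j < d \<Longrightarrow> B \<in> sets borel \<Longrightarrow> \<sigma> j absolutely_integrable_on B"
    and \<sigma>_integral: "\<And>j B. j < d \<Longrightarrow> B \<in> sets borel \<Longrightarrow>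
      integral B (\<sigma> j) = integral (Q j) (\<lambda>t. indicator B (g t) * (real_of_int (u t) * D t))"
    using \<sigma> unfolding P_def by simp_all
  show ?thesis
  proof (rule that[of \<sigma>])
    fix j x assume "j < d" "\<gamma> j x \<notin> \<phi> ` K"
    moreover have "x \<notin> g ` Q j"
    proof
      assume "x \<in> g ` Q j"
      then obtain t where t: "t \<in> Q j" "x = g t" by blast
      then have "\<phi> t = \<gamma> j x" "t \<in> K"
        using Q_arm[OF \<open>j < d\<close>] Q_K by auto
      with \<open>\<gamma> j x \<notin> \<phi> ` K\<close> show False
        by (metis imageI)
    qed
    ultimately show "\<sigma> j x = 0"
      by (intro \<sigma>_zero)
  next
    fix j assume "j < d"
    show "negligible {x \<in> {0<..<r}. \<exists>t\<in>K. \<phi> t = \<gamma> j x \<and> \<bar>\<sigma> j x\<bar> \<noteq> \<bar>real_of_int (u t)\<bar>}"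
    proof (rule negligible_subset[OF \<sigma>_abs[OF \<open>j < d\<close>]], safe)
      fix x t assume x: "x \<in> {0<..<r}" and t: "t \<in> K" "\<phi> t = \<gamma> j x"
        and neq: "\<bar>\<sigma> j x\<bar> \<noteq> \<bar>real_of_int (u t)\<bar>"
      have "g t = x"
        using g_K[OF t(1)] dist_arm[OF \<open>j < d\<close>, of x] x t(2) by simp
      moreover have "t \<in> Q j"
        using x t \<open>g t = x\<close> by (auto simp: Q_def)
      ultimately show "\<exists>t\<in>Q j. g t = x \<and> \<bar>\<sigma> j x\<bar> \<noteq> \<bar>real_of_int (u t)\<bar>"
        using neq by blast
    qed
    show "integrable lebesgue (\<sigma> j)"
      using \<sigma>_int[OF \<open>j < d\<close>, of UNIV] by (simp add: set_integrable_def)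
  next
    fix s h :: real assume sh: "0 < s" "0 < h" "s + h < r"
    let ?B = "{s..s + h}" and ?P = "\<lambda>y. ramp s h (dist y v)"
    define F where "F = (\<lambda>t. indicator ?B (g t) * (real_of_int (u t) * D t))"
    define G where "G = (\<lambda>t. \<Sum>j<d. - (1 / h) * (if t \<in> Q j then F t else 0))"
    define f where "f = (\<lambda>t. of_int (u t) * 1 * vector_derivative (\<lambda>\<tau>. ?P (\<phi> \<tau>)) (at t within K))"
    define Z where "Z = {x. \<not> (g has_real_derivative D x) (at x)} \<union> {x \<in> K. \<not> x islimpt K} \<union>
        ({t \<in> K. g t = s} \<union> {t \<in> K. g t = s + h})"
    \<comment> \<open>a sphere around \<open>v\<close> has at most one point on each arm, so the kinks of the ramp do not matter\<close>
    have level: "finite {t \<in> K. g t = c}" if "0 < c" "c < r" for c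
    proof (rule finite_imageD)
      have "\<phi> ` {t \<in> K. g t = c} \<subseteq> (\<lambda>j. \<gamma> j c) ` {..<d}"
      proof
        fix y assume "y \<in> \<phi> ` {t \<in> K. g t = c}"
        then have "dist y v = c"
          using g_K by auto
        with that have "0 < dist y v" "dist y v < r"
          by simp_all
        then obtain j where "j < d" "y \<in> \<gamma> j ` {0..r}"
          using arm_cover by blast
        then have "y = \<gamma> j c"
          using on_arm[of j y] \<open>dist y v = c\<close> by simp
        then show "y \<in> (\<lambda>j. \<gamma> j c) ` {..<d}"
          using \<open>j < d\<close> by blast
      qed
      then show "finite (\<phi> ` {t \<in> K. g t = c})"
        by (rule finite_subset) simp
      show "inj_on \<phi> {t \<in> K. g t = c}"
        using inj_\<phi> by (rule inj_on_subset) auto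
    qed
    have "negligible {x \<in> K. \<not> x islimpt K}"
      using countable_isolated_points[of K]
      by (simp add: negligible_iff_null_sets null_sets_completionI countable_imp_null_set_lborel)
    then have Z: "negligible Z"
      unfolding Z_def using D_deriv negligible_finite[OF level[of s]] negligible_finite[OF level[of "s + h"]] sh
      by (intro negligible_Un) auto
    \<comment> \<open>off \<open>Z\<close>, the derivative within \<open>K\<close> is unique and given by the chain rule\<close>
    have f_G: "f t = G t" if t: "t \<in> K - Z" for t
    proof -
      have "(ramp s h has_real_derivative (if g t \<in> ?B then - (1 / h) else 0)) (at (g t))"
        using t sh by (intro ramp_deriv) (auto simp: Z_def)
      moreover have "(g has_real_derivative D t) (at t)"
        using t by (auto simp: Z_def)
      ultimately have "((\<lambda>\<tau>. ramp s h (g \<tau>)) has_real_derivative (if g t \<in> ?B then - (1 / h) else 0) * D t) (at t)"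
        by (rule DERIV_chain2)
      then have "((\<lambda>\<tau>. ramp s h (g \<tau>)) has_vector_derivative (if g t \<in> ?B then - (1 / h) else 0) * D t) (at t within K)"
        by (simp add: has_real_derivative_iff_has_vector_derivative has_vector_derivative_at_within)
      then have "((\<lambda>\<tau>. ?P (\<phi> \<tau>)) has_vector_derivative (if g t \<in> ?B then - (1 / h) else 0) * D t) (at t within K)"
        by (rule has_vector_derivative_transform[rotated 2]) (use t g_K in auto)
      moreover have "at t within K \<noteq> bot"
        using t by (auto simp: Z_def trivial_limit_within)
      ultimately have deriv: "vector_derivative (\<lambda>\<tau>. ?P (\<phi> \<tau>)) (at t within K) = (if g t \<in> ?B then - (1 / h) else 0) * D t"
        by (intro vector_derivative_within)
      show ?thesis
      proof (cases "g t \<in> ?B")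
        case True
        then have gt: "0 < dist (\<phi> t) v" "dist (\<phi> t) v < r" "0 < g t" "g t < r"
          using sh t g_K[of t] by auto
        obtain i where i: "i < d" "\<phi> t \<in> \<gamma> i ` {0..r}"
          using arm_cover[OF gt(1,2)] by blast
        have "t \<in> Q j \<longleftrightarrow> j = i" if "j < d" for j
          using arm_unique[OF that i(1) _ i(2)] i gt t by (auto simp: Q_def)
        then have "G t = (\<Sum>j<d. if j = i then - (1 / h) * F t else 0)"
          unfolding G_def by (intro sum.cong) auto
        also have "\<dots> = - (1 / h) * F t"
          using i(1) by (simp add: sum.delta)
        finally show ?thesis
          using True by (simp add: f_def deriv F_def)
      next
        case False
        then have "F t = 0"
          by (simp add: F_def)
        then have "G t = 0"
          unfolding G_def by (intro sum.neutral) auto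
        with False show ?thesis
          by (auto simp: f_def deriv)
      qed
    qed
    have F_K: "(\<lambda>t. if t \<in> Q j then F t else 0) absolutely_integrable_on K"
        "integral K (\<lambda>t. if t \<in> Q j then F t else 0) = integral ?B (\<sigma> j)" if "j < d" for j
    proof -
      have "(\<lambda>t. if t \<in> Q j then F t else 0) absolutely_integrable_on UNIV"
        using uD_int[OF that, of ?B] unfolding F_def absolutely_integrable_restrict_UNIV by simp
      then show "(\<lambda>t. if t \<in> Q j then F t else 0) absolutely_integrable_on K"
        by (rule set_integrable_subset) (use compact_imp_closed[OF K] in auto)
      have "integral K (\<lambda>t. if t \<in> Q j then F t else 0) = integral (Q j) F"
        using Q_K by (simp add: integral_def integrable_on_def)
      also have "\<dots> = integral ?B (\<sigma> j)"
        unfolding F_def by (rule \<sigma>_integral[symmetric, OF that]) simp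
      finally show "integral K (\<lambda>t. if t \<in> Q j then F t else 0) = integral ?B (\<sigma> j)" .
    qed
    have G_int: "G absolutely_integrable_on K"
      unfolding G_def using F_K(1) by (intro absolutely_integrable_sum set_integrable_mult_right) auto
    have f_int: "f absolutely_integrable_on K"
      using G_int Z f_G by (rule absolutely_integrable_spike)
    have "chart_current K \<phi> u (\<lambda>_. 1) ?P = (LINT t:K|lebesgue. f t)"
      by (simp add: chart_current_def f_def)
    also have "\<dots> = integral K f"
      using f_int by (rule set_lebesgue_integral_eq_integral)
    also have "\<dots> = integral K G"
      using Z f_G by (rule integral_spike[symmetric])
    also have "\<dots> = (\<Sum>j<d. integral K (\<lambda>t. - (1 / h) * (if t \<in> Q j then F t else 0)))"
      unfolding G_def using F_K(1)
      by (intro Henstock_Kurzweil_Integration.integral_sum integrable_on_mult_right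
          set_lebesgue_integral_eq_integral(1)) auto
    also have "\<dots> = (\<Sum>j<d. - (1 / h) * integral ?B (\<sigma> j))"
      using F_K(2) by (intro sum.cong refl) (simp add: integral_mult_right del: mult_minus_left)
    finally show "chart_current K \<phi> u (\<lambda>_. 1) ?P = - (1 / h) * (\<Sum>j<d. integral ?B (\<sigma> j))"
      by (simp add: sum_distrib_left)
  qed
qed

end

section \<open>Parity of the boundary coefficient\<close>

text \<open>Changing one sign changes the sum by 2.\<close>

lemma sum_of_signs_parity:
  fixes w :: "nat \<Rightarrow> real"
  assumes "\<And>j. j < d \<Longrightarrow> \<bar>w j\<bar> = 1"
  shows "\<exists>k :: int. (\<Sum>j<d. w j) = real_of_int (int d - 2 * k)"
  using assms
proof (induction d)
  case 0
  show ?case by (intro exI[of _ 0]) simp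
next
  case (Suc d)
  then obtain k :: int where k: "(\<Sum>j<d. w j) = real_of_int (int d - 2 * k)"
    by auto
  have "w d = 1 \<or> w d = - 1"
    using Suc.prems[of d] by (auto simp: abs_if split: if_splits)
  then show ?case
    using k by (elim disjE) (intro exI[of _ k], simp, intro exI[of _ "k + 1"], simp)
qed

theorem theorem1p1:
  fixes E :: "'e set" and len :: "'e \<Rightarrow> real" and c :: "'e \<Rightarrow> real \<Rightarrow> 'a::complete_space"
    and v :: 'a and d :: nat and U :: "'a set"
    and S :: "'a functional1" and \<theta> :: "'a \<Rightarrow> nat"
    and N :: nat and m :: "nat \<Rightarrow> int" and x :: "nat \<Rightarrow> 'a" and mv :: int
  assumes "metric_graph_like E len c"
    and "v isolated_in complex_vertices E len c"
    and "star_neighbourhood (complex_vertices E len c) v d U"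
    and "S \<in> \<I>\<^sub>1"
    and "has_multiplicity S \<theta>"
    and "\<forall>C\<in>components (U - {v}). hausdorff1 {y \<in> C. \<theta> y \<noteq> 1} = 0"
    and "\<forall>f. lip_b f \<longrightarrow> boundary S f = (\<Sum>j=1..N. of_int (m j) * point_current (x j) f)"
    and "inj_on x {1..N}"
    and "\<forall>j\<in>{1..N}. m j \<noteq> 0"
    and "\<forall>j\<in>{1..N}. x j = v \<longrightarrow> mv = m j"
    and "v \<notin> x ` {1..N} \<Longrightarrow> mv = 0"
  shows "[mv = int d] (mod 2) \<and> (odd d \<longrightarrow> mv \<noteq> 0)"
proof -
  obtain \<rho> \<gamma> where "\<rho> > 0" and star:
      "(\<forall>i<d. \<gamma> i 0 = v \<and> (\<forall>s\<in>{0..\<rho>}. \<forall>t\<in>{0..\<rho>}. dist (\<gamma> i s) (\<gamma> i t) = \<bar>s - t\<bar>)) \<and>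
        (\<forall>i<d. \<forall>j<d. i \<noteq> j \<longrightarrow> \<gamma> i ` {0..\<rho>} \<inter> \<gamma> j ` {0..\<rho>} = {v}) \<and>
        U = insert v (\<Union>i<d. \<gamma> i ` {0..<\<rho>}) \<and>
        v \<in> interior U \<and> U \<inter> closure (complex_vertices E len c) = {v}"
    using assms(3) unfolding star_neighbourhood_def by (elim exE conjE) (rule that, assumption, intro conjI)
  have \<gamma>: "\<And>i. i < d \<Longrightarrow> \<gamma> i 0 = v"
    and \<gamma>_iso: "\<And>i s t. i < d \<Longrightarrow> s \<in> {0..\<rho>} \<Longrightarrow> t \<in> {0..\<rho>} \<Longrightarrow> dist (\<gamma> i s) (\<gamma> i t) = \<bar>s - t\<bar>"
    and \<gamma>_disj: "\<And>i j. i < d \<Longrightarrow> j < d \<Longrightarrow> i \<noteq> j \<Longrightarrow> \<gamma> i ` {0..\<rho>} \<inter> \<gamma> j ` {0..\<rho>} = {v}"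
    and U: "U = insert v (\<Union>i<d. \<gamma> i ` {0..<\<rho>})"
    using star by simp_all
  have "v \<in> interior U"
    using star by blast
  obtain e where "e > 0" and e: "ball v e \<subseteq> U"
    using \<open>v \<in> interior U\<close> by (meson mem_interior)
  \<comment> \<open>\<open>R\<close> is so small that the ball of radius \<open>R\<close> lies in \<open>U\<close> and meets the boundary at most in \<open>v\<close>\<close>
  define A where "A = {\<rho>, e} \<union> (\<lambda>j. dist (x j) v) ` {j \<in> {1..N}. x j \<noteq> v}"
  define R where "R = Min A"
  have A: "finite A" "A \<noteq> {}"
    by (simp_all add: A_def)
  have R_le: "R \<le> a" if "a \<in> A" for a
    unfolding R_def using A(1) that by (rule Min_le)
  have R: "R > 0" "R \<le> \<rho>" "R \<le> e"
  proof -
    have "\<forall>a\<in>A. a > 0"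
      using \<open>\<rho> > 0\<close> \<open>e > 0\<close> by (auto simp: A_def)
    then show "R > 0"
      unfolding R_def using A by (simp add: Min_gr_iff)
  qed (rule R_le, simp add: A_def)+
  have R_x: "R \<le> dist (x j) v" if "j \<in> {1..N}" "x j \<noteq> v" for j
    using that by (intro R_le) (auto simp: A_def)
  interpret star_arms v d R \<gamma>
  proof
    show "dist (\<gamma> j s) (\<gamma> j t) = \<bar>s - t\<bar>" if "j < d" "s \<in> {0..R}" "t \<in> {0..R}" for j s t
      using \<gamma>_iso that R by auto
    show "\<gamma> j 0 = v" if "j < d" for j
      using \<gamma> that .
    show "\<exists>j<d. y \<in> \<gamma> j ` {0..R}" if y: "0 < dist y v" "dist y v < R" for y
    proof -
      have "y \<in> U" "y \<noteq> v"
        using e R y by (auto simp: dist_commute)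
      then obtain i a where "i < d" "a \<in> {0..<\<rho>}" "y = \<gamma> i a"
        unfolding U by auto
      moreover from this have "dist y v = a"
        using \<gamma>[of i] \<gamma>_iso[of i a 0] \<open>\<rho> > 0\<close> by simp
      ultimately show ?thesis
        using y by (intro exI[of _ i]) auto
    qed
    show "\<gamma> i ` {0..R} \<inter> \<gamma> j ` {0..R} = {v}" if "i < d" "j < d" "i \<noteq> j" for i j
    proof -
      have "\<gamma> i ` {0..R} \<inter> \<gamma> j ` {0..R} \<subseteq> \<gamma> i ` {0..\<rho>} \<inter> \<gamma> j ` {0..\<rho>}"
        using R by (intro Int_mono image_mono) auto
      moreover have "v \<in> \<gamma> i ` {0..R}" "v \<in> \<gamma> j ` {0..R}"
        using \<gamma>[OF that(1)] \<gamma>[OF that(2)] R by (force intro: image_eqI[of _ _ 0])+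
      ultimately show ?thesis
        using \<gamma>_disj[OF that] by auto
    qed
  qed

  obtain K \<phi> u where rep:
      "(\<forall>i :: nat. compact (K i) \<and> bi_lipschitz_on (K i) (\<phi> i) \<and>
           integrable lebesgue (\<lambda>t. real_of_int (u i t)) \<and> (\<forall>t. t \<notin> K i \<longrightarrow> u i t = 0)) \<and>
        disjoint_family (\<lambda>i. \<phi> i ` K i) \<and>
        (\<forall>f \<pi>. lip_b f \<longrightarrow> lip \<pi> \<longrightarrow>
           (\<lambda>i. chart_current (K i) (\<phi> i) (u i) f \<pi>) sums S f \<pi>) \<and>
        (\<lambda>i. mass (chart_current (K i) (\<phi> i) (u i))) sums mass S \<and>
        (\<forall>i. \<forall>t\<in>K i. \<theta> (\<phi> i t) = nat \<bar>u i t\<bar>) \<and>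
        (\<forall>x. x \<notin> (\<Union>i. \<phi> i ` K i) \<longrightarrow> \<theta> x = 0)"
    using assms(5) unfolding has_multiplicity_def by (elim exE) (rule that)
  have K: "\<And>i. compact (K i)" and bi: "\<And>i. bi_lipschitz_on (K i) (\<phi> i)"
    and u: "\<And>i. integrable lebesgue (\<lambda>t. real_of_int (u i t))"
    and dis: "disjoint_family (\<lambda>i. \<phi> i ` K i)"
    and S_sums: "\<And>f \<pi>. lip_b f \<Longrightarrow> lip \<pi> \<Longrightarrow> (\<lambda>i. chart_current (K i) (\<phi> i) (u i) f \<pi>) sums S f \<pi>"
    and \<theta>_u: "\<And>i t. t \<in> K i \<Longrightarrow> \<theta> (\<phi> i t) = nat \<bar>u i t\<bar>"
    and \<theta>_0: "\<And>x. x \<notin> (\<Union>i. \<phi> i ` K i) \<Longrightarrow> \<theta> x = 0"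
    using rep by simp_all

  define P where "P i \<sigma> \<longleftrightarrow> (\<forall>j<d. (\<forall>x. \<gamma> j x \<notin> \<phi> i ` K i \<longrightarrow> \<sigma> j x = 0) \<and>
      negligible {x \<in> {0<..<R}. \<exists>t\<in>K i. \<phi> i t = \<gamma> j x \<and> \<bar>\<sigma> j x\<bar> \<noteq> \<bar>real_of_int (u i t)\<bar>} \<and>
      integrable lebesgue (\<sigma> j)) \<and>
    (\<forall>s h. 0 < s \<longrightarrow> 0 < h \<longrightarrow> s + h < R \<longrightarrow>
      chart_current (K i) (\<phi> i) (u i) (\<lambda>_. 1) (\<lambda>y. ramp s h (dist y v))
        = - (1 / h) * (\<Sum>j<d. integral {s..s + h} (\<sigma> j)))" for i and \<sigma> :: "nat \<Rightarrow> real \<Rightarrow> real"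
  have "\<exists>\<sigma>. P i \<sigma>" for i
  proof (rule chart_current_ramp[OF K[of i] bi[of i] u[of i]])
    fix \<sigma> :: "nat \<Rightarrow> real \<Rightarrow> real"
    assume *: "\<And>j x. j < d \<Longrightarrow> \<gamma> j x \<notin> \<phi> i ` K i \<Longrightarrow> \<sigma> j x = 0"
      "\<And>j. j < d \<Longrightarrow> negligible {x \<in> {0<..<R}. \<exists>t\<in>K i. \<phi> i t = \<gamma> j x \<and> \<bar>\<sigma> j x\<bar> \<noteq> \<bar>real_of_int (u i t)\<bar>}"
      "\<And>j. j < d \<Longrightarrow> integrable lebesgue (\<sigma> j)"
      "\<And>s h. 0 < s \<Longrightarrow> 0 < h \<Longrightarrow> s + h < R \<Longrightarrow>
       chart_current (K i) (\<phi> i) (u i) (\<lambda>_. 1) (\<lambda>y. ramp s h (dist y v))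
         = - (1 / h) * (\<Sum>j<d. integral {s..s + h} (\<sigma> j))"
    have "P i \<sigma>"
      unfolding P_def by (intro conjI allI impI *)
    then show "\<exists>\<sigma>. P i \<sigma>"
      by blast
  qed
  then obtain \<sigma> where \<sigma>: "\<And>i. P i (\<sigma> i)"
    by metis
  have \<sigma>_zero: "\<And>i j x. j < d \<Longrightarrow> \<gamma> j x \<notin> \<phi> i ` K i \<Longrightarrow> \<sigma> i j x = 0"
    and \<sigma>_abs: "\<And>i j. j < d \<Longrightarrow>
      negligible {x \<in> {0<..<R}. \<exists>t\<in>K i. \<phi> i t = \<gamma> j x \<and> \<bar>\<sigma> i j x\<bar> \<noteq> \<bar>real_of_int (u i t)\<bar>}"
    and \<sigma>_int: "\<And>i j. j < d \<Longrightarrow> integrable lebesgue (\<sigma> i j)"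
    and chart: "\<And>i s h. 0 < s \<Longrightarrow> 0 < h \<Longrightarrow> s + h < R \<Longrightarrow>
      chart_current (K i) (\<phi> i) (u i) (\<lambda>_. 1) (\<lambda>y. ramp s h (dist y v))
        = - (1 / h) * (\<Sum>j<d. integral {s..s + h} (\<sigma> i j))"
    using \<sigma> unfolding P_def by simp_all

  \<comment> \<open>an open arm is connected, so it lies in a single component of \<open>U - {v}\<close>\<close>
  have \<theta>_arm: "negligible {s \<in> {0<..<R}. \<theta> (\<gamma> j s) \<noteq> 1}" if j: "j < d" for j
  proof (rule negligible_hausdorff1_null)
    show "\<bar>s - t\<bar> \<le> dist (\<gamma> j s) (\<gamma> j t)"
      if "s \<in> {s \<in> {0<..<R}. \<theta> (\<gamma> j s) \<noteq> 1}" "t \<in> {s \<in> {0<..<R}. \<theta> (\<gamma> j s) \<noteq> 1}" for s t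
      using arm_isometric[OF j, of s t] that by auto
    have "1-lipschitz_on {0<..<R} (\<gamma> j)"
      using arm_isometric[OF j] by (intro lipschitz_onI) (auto simp: dist_real_def)
    then have "connected (\<gamma> j ` {0<..<R})"
      by (intro connected_continuous_image lipschitz_on_continuous_on) auto
    moreover have "\<gamma> j ` {0<..<R} \<subseteq> U - {v}"
    proof
      fix y assume "y \<in> \<gamma> j ` {0<..<R}"
      then obtain s where s: "s \<in> {0<..<R}" "y = \<gamma> j s"
        by blast
      then have "y \<in> \<gamma> j ` {0..<\<rho>}"
        using R by auto
      then have "y \<in> U"
        using j unfolding U by blast
      moreover have "y \<noteq> v"
        using dist_arm[OF j, of s] s by auto
      ultimately show "y \<in> U - {v}"
        by blast
    qed
    moreover have "\<gamma> j (R / 2) \<in> \<gamma> j ` {0<..<R}"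
      using R by simp
    ultimately obtain C where C: "C \<in> components (U - {v})" "\<gamma> j ` {0<..<R} \<subseteq> C"
      using exists_component_superset[of "\<gamma> j ` {0<..<R}" "U - {v}"] by blast
    have mono: "hausdorff1 A \<le> hausdorff1 B" if "A \<subseteq> B" for A B :: "'a set"
      unfolding hausdorff1_def hausdorff1_premeasure_def using that
      by (intro SUP_mono' INF_superset_mono) auto
    have "hausdorff1 (\<gamma> j ` {s \<in> {0<..<R}. \<theta> (\<gamma> j s) \<noteq> 1}) \<le> hausdorff1 {y \<in> C. \<theta> y \<noteq> 1}"
      using C(2) by (intro mono) auto
    also have "\<dots> = 0"
      using assms(6) C(1) by blast
    finally show "hausdorff1 (\<gamma> j ` {s \<in> {0<..<R}. \<theta> (\<gamma> j s) \<noteq> 1}) = 0"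
      by simp
  qed

  define Z where "Z = (\<Union>j<d. {s \<in> {0<..<R}. \<theta> (\<gamma> j s) \<noteq> 1} \<union>
      (\<Union>i. {x \<in> {0<..<R}. \<exists>t\<in>K i. \<phi> i t = \<gamma> j x \<and> \<bar>\<sigma> i j x\<bar> \<noteq> \<bar>real_of_int (u i t)\<bar>}))"
  have "negligible (\<Union>i. {x \<in> {0<..<R}. \<exists>t\<in>K i. \<phi> i t = \<gamma> j x \<and> \<bar>\<sigma> i j x\<bar> \<noteq> \<bar>real_of_int (u i t)\<bar>})"
    if "j < d" for j
    using \<sigma>_abs[OF that] by (intro negligible_countable_Union) blast+
  then have Z: "negligible Z"
    unfolding Z_def using \<theta>_arm by (intro negligible_Union finite_imageI finite_lessThan) (blast intro: negligible_Un)
  \<comment> \<open>the charts have disjoint images, so a point of multiplicity one lies in exactly one of them\<close>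
  have unit: "\<exists>i. \<bar>\<sigma> i j s\<bar> = 1 \<and> (\<forall>k. k \<noteq> i \<longrightarrow> \<sigma> k j s = 0)"
    if "j < d" "s \<in> {0<..<R}" "s \<notin> Z" for j s
  proof -
    have \<theta>1: "\<theta> (\<gamma> j s) = 1"
      using that by (auto simp: Z_def)
    then obtain i t where t: "t \<in> K i" "\<gamma> j s = \<phi> i t"
      using \<theta>_0[of "\<gamma> j s"] by auto
    have "\<bar>u i t\<bar> = 1"
      using \<theta>_u[OF t(1)] \<theta>1 t(2) by simp
    moreover have "\<bar>\<sigma> i j s\<bar> = \<bar>real_of_int (u i t)\<bar>"
      using that t by (auto simp: Z_def)
    ultimately have "\<bar>\<sigma> i j s\<bar> = 1"
      by linarith
    moreover have "\<sigma> k j s = 0" if "k \<noteq> i" for k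
    proof (rule \<sigma>_zero[OF \<open>j < d\<close>])
      show "\<gamma> j s \<notin> \<phi> k ` K k"
        using dis t that by (auto simp: disjoint_family_on_def)
    qed
    ultimately show ?thesis
      by blast
  qed

  define w where "w j s = (\<Sum>i. \<sigma> i j s)" for j s
  have w_unit: "\<bar>w j s\<bar> = 1" if "j < d" "s \<in> {0<..<R}" "s \<notin> Z" for j s
  proof -
    from unit[OF that] obtain i where i: "\<bar>\<sigma> i j s\<bar> = 1" "\<forall>k. k \<noteq> i \<longrightarrow> \<sigma> k j s = 0"
      by blast
    have "(\<lambda>k. \<sigma> k j s) = (\<lambda>k. if k = i then \<sigma> i j s else 0)"
      using i(2) by (simp add: fun_eq_iff)
    then have "w j s = \<sigma> i j s"
      unfolding w_def using sums_single[of i "\<lambda>_. \<sigma> i j s"] by (simp add: sums_iff)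
    with i(1) show ?thesis by simp
  qed
  have w_int: "w j absolutely_integrable_on {a..b}"
    and w_sums: "(\<lambda>i. integral {a..b} (\<sigma> i j)) sums integral {a..b} (w j)"
    if "j < d" "0 < a" "b < R" for j a b
  proof -
    have "negligible {s \<in> {a..b}. \<not> (\<exists>i. \<bar>\<sigma> i j s\<bar> = 1 \<and> (\<forall>k. k \<noteq> i \<longrightarrow> \<sigma> k j s = 0))}"
    proof (rule negligible_subset[OF Z], rule subsetI, rule ccontr)
      fix s assume s: "s \<in> {s \<in> {a..b}. \<not> (\<exists>i. \<bar>\<sigma> i j s\<bar> = 1 \<and> (\<forall>k. k \<noteq> i \<longrightarrow> \<sigma> k j s = 0))}" "s \<notin> Z"
      then have "s \<in> {0<..<R}"
        using that by auto
      then show False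
        using s unit[OF \<open>j < d\<close>] by blast
    qed
    from sums_integral_disjoint_unit[OF \<sigma>_int[OF \<open>j < d\<close>] this]
    show "w j absolutely_integrable_on {a..b}"
      "(\<lambda>i. integral {a..b} (\<sigma> i j)) sums integral {a..b} (w j)"
      unfolding w_def by blast+
  qed
  define W where "W s = (\<Sum>j<d. w j s)" for s
  have W_int: "W absolutely_integrable_on {a..b}" if "0 < a" "b < R" for a b
    unfolding W_def using w_int that by (intro absolutely_integrable_sum) auto

  \<comment> \<open>both sides are \<open>-h \<partial>S(?P)\<close>, the right one by the formula for \<open>\<partial>S\<close>\<close>
  have avg: "integral {s..s + h} W = - real_of_int mv * h" if sh: "0 < s" "0 < h" "s + h < R" for s h
  proof -
    let ?P = "\<lambda>y. ramp s h (dist y v)"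
    have "(1 / h)-lipschitz_on UNIV ?P"
    proof (rule lipschitz_onI)
      fix y z :: 'a
      have "dist (?P y) (?P z) \<le> (1 / h) * \<bar>dist y v - dist z v\<bar>"
        using ramp_lipschitz[OF \<open>0 < h\<close>] by (simp add: dist_real_def)
      also have "\<dots> \<le> (1 / h) * dist y z"
        using \<open>0 < h\<close> abs_dist_diff_le[of y v z] by (intro mult_left_mono) (auto simp: dist_commute)
      finally show "dist (?P y) (?P z) \<le> (1 / h) * dist y z" .
    qed (use \<open>0 < h\<close> in simp)
    then have "lip ?P"
      by (auto simp: lip_def)
    moreover have "bounded (range ?P)"
      by (intro boundedI[of _ 1]) (auto simp: ramp_bounds abs_of_nonneg)
    ultimately have P_lip: "lip ?P" "lip_b ?P"
      by (auto simp: lip_b_def)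
    have "lip_b (\<lambda>_ :: 'a. 1)"
      unfolding lip_b_def lip_def using lipschitz_intros(1) by (auto intro!: exI[of _ 0] lipschitz_onI)
    have P_x: "?P (x j) = (if x j = v then 1 else 0)" if "j \<in> {1..N}" for j
      using R_x[OF that] sh by (auto simp: ramp_inner ramp_outer)
    have "S (\<lambda>_. 1) ?P = (\<Sum>j=1..N. of_int (m j) * ?P (x j))"
      using assms(7) P_lip(2) by (simp add: boundary_def point_current_def)
    also have "\<dots> = (\<Sum>j=1..N. if x j = v then of_int (m j) else 0)"
      using P_x by (intro sum.cong) auto
    also have "\<dots> = real_of_int mv"
    proof (cases "v \<in> x ` {1..N}")
      case True
      then obtain i where i: "i \<in> {1..N}" "x i = v" by auto
      have "x j = v \<longleftrightarrow> j = i" if "j \<in> {1..N}" for j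
        using inj_onD[OF assms(8), of j i] i that by auto
      then have "(\<Sum>j=1..N. if x j = v then real_of_int (m j) else 0) = (\<Sum>j=1..N. if j = i then real_of_int (m j) else 0)"
        by (intro sum.cong) simp_all
      also have "\<dots> = real_of_int (m i)"
        using i by (simp add: sum.delta)
      also have "m i = mv"
        using assms(10) i by blast
      finally show ?thesis .
    next
      case False
      then have "(\<Sum>j=1..N. if x j = v then real_of_int (m j) else 0) = 0"
        by (intro sum.neutral) auto
      with assms(11)[OF False] show ?thesis by simp
    qed
    finally have mv: "S (\<lambda>_. 1) ?P = real_of_int mv" .
    have "(\<lambda>i. - (1 / h) * (\<Sum>j<d. integral {s..s + h} (\<sigma> i j))) sums real_of_int mv"
      using S_sums[OF \<open>lip_b (\<lambda>_. 1)\<close> P_lip(1)] mv chart[OF sh] by simp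
    moreover have "(\<lambda>i. - (1 / h) * (\<Sum>j<d. integral {s..s + h} (\<sigma> i j))) sums
        (- (1 / h) * (\<Sum>j<d. integral {s..s + h} (w j)))"
      using w_sums sh by (intro sums_mult sums_sum) auto
    ultimately have "real_of_int mv = - (1 / h) * (\<Sum>j<d. integral {s..s + h} (w j))"
      by (rule sums_unique2)
    also have "(\<Sum>j<d. integral {s..s + h} (w j)) = integral {s..s + h} W"
      unfolding W_def using w_int sh
      by (intro Henstock_Kurzweil_Integration.integral_sum[symmetric] set_lebesgue_integral_eq_integral(1)) auto
    finally show ?thesis
      using \<open>0 < h\<close> by (simp add: field_simps)
  qed

  have "negligible {s \<in> {R / 3<..<2 * R / 3}. W s \<noteq> - real_of_int mv}"
    using R by (intro negligible_interval_averages_neq W_int avg) auto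
  then have "negligible ({s \<in> {R / 3<..<2 * R / 3}. W s \<noteq> - real_of_int mv} \<union> Z)"
    using Z by (rule negligible_Un)
  moreover have "\<not> negligible {R / 3<..<2 * R / 3}"
    using R open_not_negligible[of "{R / 3<..<2 * R / 3}"] by simp
  ultimately obtain s where s: "s \<in> {R / 3<..<2 * R / 3}" "W s = - real_of_int mv" "s \<notin> Z"
    using negligible_subset by blast
  have "s \<in> {0<..<R}"
    using s(1) R by auto
  obtain k :: int where "W s = real_of_int (int d - 2 * k)"
    unfolding W_def using sum_of_signs_parity[of d "\<lambda>j. w j s"] w_unit \<open>s \<in> {0<..<R}\<close> s(3) by blast
  with s(2) have "real_of_int (- mv) = real_of_int (int d - 2 * k)"
    by simp
  then have mv: "mv = 2 * k - int d"
    unfolding of_int_eq_iff by simp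
  have "2 dvd mv - int d"
    unfolding mv by (intro dvdI[of _ _ "k - int d"]) simp
  then have "[mv = int d] (mod 2)"
    by (simp add: cong_iff_dvd_diff)
  moreover have "mv \<noteq> 0" if "odd d"
    using mv that by presburger
  ultimately show ?thesis
    by blast
qed

end
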